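(* Let $X$ be a locally convex space belonging to the class $\mathfrak M$. Then there is a hereditarily hypercyclic (and therefore mixing) operator $T\in L(X)$.
   Context: Conventions: $\mathbb K$ is $\mathbb R$ or $\mathbb C$; all vector spaces are non-zero and over $\mathbb K$; all topological spaces are Hausdorff; $\mathbb Z_+=\{0,1,2,\dots\}$. $L(X)$ is the space of continuous linear operators on $X$. The topology of a locally convex space $X$ is called weak if it coincides with $\sigma(X,Y)$ (the weakest topology making all functionals in $Y$ continuous) for some linear space $Y$ of linear functionals on $X$ separating points of $X$. A sequence $\{x_n\}_{n\in\mathbb Z_+}$ in a topological vector space $X$ is an $\ell_1$-sequence if $x_n\to0$ in $X$ and $\sum_{n=0}^\infty a_nx_n$ converges in $X$ for each $a\in\ell_1$. A locally convex space $X$ belongs to the class $\mathfrak M$ if its topology is not weak and there exists an $\ell_1$-sequence in $X$ with dense linear span. An operator $T\in L(X)$ is hereditarily hypercyclic if for any sequence $\{n_k\}_{k\in\mathbb Z_+}$ of non-negative integers with $n_k\to\infty$ there is $x\in X$ such that $\{T^{n_k}x:k\in\mathbb Z_+\}$ is dense in $X$. $T$ is mixing if for any non-empty open $U,V\subseteq X$ there is $r>0$ such that $T^n(U)\cap V\neq\varnothing$ for all integers $n>r$. *)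

theory Defs
  imports "HOL-Analysis.Analysis"
begin

text \<open>
  The library has no class of vector spaces over the complex numbers, so the scalar multiplication
  is an explicit parameter, as in the library locale \<^locale>\<open>vector_space\<close>. The scalar type
  ranges over normed fields in the definitions and is only ever instantiated to the reals and to the
  complex numbers. The space itself is a whole type, with its topology given by the type class.
\<close>

definition convex_over :: "('k::real_normed_field \<Rightarrow> 'a::ab_group_add \<Rightarrow> 'a) \<Rightarrow> 'a set \<Rightarrow> bool" where
  "convex_over smul C \<longleftrightarrow>
     (\<forall>x\<in>C. \<forall>y\<in>C. \<forall>u\<ge>0. \<forall>v\<ge>0. u + v = 1 \<longrightarrow>
        smul (of_real u) x + smul (of_real v) y \<in> C)"

text \<open>
  Joint continuity of addition and continuity of negation come from
  \<^class>\<open>topological_ab_group_add\<close>; the Hausdorff property comes from \<^class>\<open>t2_space\<close>.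
  Vector spaces are non-zero by convention.
\<close>

locale locally_convex_space = vector_space smul
  for smul :: "'k::real_normed_field \<Rightarrow> 'a::{topological_ab_group_add, t2_space} \<Rightarrow> 'a" +
  assumes nonzero: "\<exists>x::'a. x \<noteq> 0"
    and continuous_scale: "continuous_on UNIV (\<lambda>(c, x). smul c x)"
    and locally_convex:
      "\<And>U. open U \<Longrightarrow> 0 \<in> U \<Longrightarrow> \<exists>C. convex_over smul C \<and> 0 \<in> interior C \<and> C \<subseteq> U"

definition continuous_linear_operators ::
  "('k::real_normed_field \<Rightarrow> 'a::{ab_group_add, topological_space} \<Rightarrow> 'a) \<Rightarrow> ('a \<Rightarrow> 'a) set" where
  "continuous_linear_operators smul =
     {T. Vector_Spaces.linear smul smul T \<and> continuous_on UNIV T}"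

text \<open>
  The functionals in \<open>Y\<close> are not required to be continuous: this follows once the
  topology is \<open>\<sigma>(X, Y)\<close>.
\<close>

definition separating_functional_space ::
  "('k::real_normed_field \<Rightarrow> 'a::ab_group_add \<Rightarrow> 'a) \<Rightarrow> ('a \<Rightarrow> 'k) set \<Rightarrow> bool" where
  "separating_functional_space smul Y \<longleftrightarrow>
     (\<forall>f\<in>Y. Vector_Spaces.linear smul (*) f) \<and>
     (\<lambda>x. 0) \<in> Y \<and>
     (\<forall>f\<in>Y. \<forall>g\<in>Y. (\<lambda>x. f x + g x) \<in> Y) \<and>
     (\<forall>c. \<forall>f\<in>Y. (\<lambda>x. c * f x) \<in> Y) \<and>
     (\<forall>x y. x \<noteq> y \<longrightarrow> (\<exists>f\<in>Y. f x \<noteq> f y))"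

definition sigma_open :: "('a \<Rightarrow> 'k::topological_space) set \<Rightarrow> 'a set \<Rightarrow> bool" where
  "sigma_open Y = generate_topology {f -` U | f U. f \<in> Y \<and> open U}"

definition has_weak_topology ::
  "('k::real_normed_field \<Rightarrow> 'a::{ab_group_add, topological_space} \<Rightarrow> 'a) \<Rightarrow> bool" where
  "has_weak_topology smul \<longleftrightarrow>
     (\<exists>Y. separating_functional_space smul Y \<and> (\<forall>S. open S \<longleftrightarrow> sigma_open Y S))"

text \<open>
  The membership \<open>a \<in> \<ell>\<^sub>1\<close> is summability of the norms; \<^const>\<open>summable\<close> is
  convergence of the sequence of partial sums in the topology of the space.
\<close>

definition ell1_sequence ::
  "('k::real_normed_field \<Rightarrow> 'a::{ab_group_add, topological_space} \<Rightarrow> 'a) \<Rightarrow> (nat \<Rightarrow> 'a) \<Rightarrow> bool" where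
  "ell1_sequence smul x \<longleftrightarrow>
     x \<longlonglongrightarrow> 0 \<and>
     (\<forall>a. summable (\<lambda>n. norm (a n)) \<longrightarrow> summable (\<lambda>n. smul (a n) (x n)))"

definition class_M ::
  "('k::real_normed_field \<Rightarrow> 'a::{topological_ab_group_add, t2_space} \<Rightarrow> 'a) \<Rightarrow> bool" where
  "class_M smul \<longleftrightarrow>
     locally_convex_space smul \<and>
     \<not> has_weak_topology smul \<and>
     (\<exists>x. ell1_sequence smul x \<and> closure (module.span smul (range x)) = UNIV)"

definition hereditarily_hypercyclic :: "('a::topological_space \<Rightarrow> 'a) \<Rightarrow> bool" where
  "hereditarily_hypercyclic T \<longleftrightarrow>
     (\<forall>n :: nat \<Rightarrow> nat. filterlim n at_top sequentially \<longrightarrow>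
        (\<exists>x. closure (range (\<lambda>k. (T ^^ n k) x)) = UNIV))"

definition mixing :: "('a::topological_space \<Rightarrow> 'a) \<Rightarrow> bool" where
  "mixing T \<longleftrightarrow>
     (\<forall>U V. open U \<and> U \<noteq> {} \<and> open V \<and> V \<noteq> {} \<longrightarrow>
        (\<exists>r>0. \<forall>n>r. (T ^^ n) ` U \<inter> V \<noteq> {}))"

end

theory Submission
  imports Defs
begin

text \<open>
  The operator is a copy of the translation \<open>P(z) \<mapsto> P(z + 1)\<close> of polynomials. As the topology is
  not weak, the Hahn-Banach theorem yields a continuous seminorm \<open>p\<close> dominating an
  infinite-dimensional space of functionals, and from an \<open>\<ell>\<^sub>1\<close>-sequence with dense span one builds
  a biorthogonal system \<open>(e\<^sub>k, g\<^sub>k)\<close> with dense span, where \<open>e\<^sub>k\<close> lies in a multiple of the image of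
  the unit ball of \<open>\<ell>\<^sub>1\<close> and \<open>g\<^sub>k\<close> is so small compared with \<open>p\<close> that
  \<open>T x = x + (\<Sum>k. g\<^sub>k(x) (\<Sum>j<k. (k choose j) e\<^sub>j))\<close> converges and is continuous. Identifying
  \<open>e\<^sub>k\<close> with \<open>z^k\<close> turns \<open>T\<close> into the translation by 1. Given polynomials \<open>u\<close> and \<open>v\<close>,
  Hermite interpolation at \<open>0\<close> and \<open>n\<close> gives polynomials \<open>w\<^sub>n\<close> of bounded degree with
  \<open>w\<^sub>n(z) \<rightarrow> u(z)\<close> and \<open>w\<^sub>n(z + n) \<rightarrow> v(z)\<close> coefficientwise. This is mixing, and summing such
  corrections along any sequence \<open>n\<^sub>k \<rightarrow> \<infinity>\<close> gives a vector with dense orbit along the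
  sequence; the sums converge because the image of \<open>\<ell>\<^sub>1\<close> is complete for its quotient norm.
\<close>

section \<open>Norming functionals\<close>

lemma (in vector_space) linear_functional_iff:
  "Vector_Spaces.linear scale (*) f \<longleftrightarrow>
     (\<forall>x y. f (x + y) = f x + f y) \<and> (\<forall>c x. f (scale c x) = c * f x)"
  using vector_space_axioms
  by (auto simp: Vector_Spaces.linear_iff vector_space_def algebra_simps)

lemma (in vector_space) linear_functional_diff:
  assumes "Vector_Spaces.linear scale (*) f"
  shows "f (x - y) = f x - f y"
proof -
  have "f (x - y + y) = f (x - y) + f y" using assms linear_functional_iff by blast
  then show ?thesis by simp
qed

section \<open>Real Hahn-Banach theorem by minimal sublinear functionals\<close>

definition sublinear_functional :: "(real \<Rightarrow> 'a::ab_group_add \<Rightarrow> 'a) \<Rightarrow> ('a \<Rightarrow> real) \<Rightarrow> bool" where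
  "sublinear_functional s q \<longleftrightarrow>
     (\<forall>x y. q (x + y) \<le> q x + q y) \<and> (\<forall>t x. t > 0 \<longrightarrow> q (s t x) = t * q x)"

lemma sublinear_functional_zero:
  assumes "vector_space s" "sublinear_functional s q"
  shows "q 0 = 0"
proof -
  interpret vector_space s by fact
  have "q (s 2 0) = 2 * q 0"
    using assms(2) unfolding sublinear_functional_def by (metis zero_less_numeral)
  then show ?thesis by simp
qed

text \<open>Comes from \<open>q 0 = 0\<close> and \<open>q (x + - x) \<le> q x + q (- x)\<close>.
  The bound depends on \<open>p\<close> only, which keeps pointwise infima of chains below
  \<open>p\<close> finite.\<close>

lemma sublinear_functional_lower_bound:
  assumes "vector_space s" "sublinear_functional s q" "q \<le> p"
  shows "- p (- x) \<le> q x"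
proof -
  have "q (x + - x) \<le> q x + q (- x)" using assms(2) unfolding sublinear_functional_def by blast
  moreover have "q (- x) \<le> p (- x)" using assms(3) by (simp add: le_fun_def)
  ultimately show ?thesis using sublinear_functional_zero[OF assms(1,2)] by simp
qed

text \<open>The pointwise infimum works. In the subadditivity estimate, comparability lets the
  smaller of two members of the chain replace both of them. This supplies the bounds that Zorn's
  lemma asks for.\<close>

lemma sublinear_functional_Inf_chain:
  assumes vs: "vector_space s" and ne: "Q \<noteq> {}"
    and sub: "\<And>q. q \<in> Q \<Longrightarrow> sublinear_functional s q \<and> q \<le> p"
    and chain: "\<And>q q'. q \<in> Q \<Longrightarrow> q' \<in> Q \<Longrightarrow> q \<le> q' \<or> q' \<le> q"
  shows "\<exists>q\<^sub>0. sublinear_functional s q\<^sub>0 \<and> (\<forall>q\<in>Q. q\<^sub>0 \<le> q)"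
proof -
  define q\<^sub>0 where "q\<^sub>0 x = (INF q\<in>Q. q x)" for x
  have bdd: "bdd_below ((\<lambda>q. q x) ` Q)" for x
    using sublinear_functional_lower_bound[OF vs] sub by (intro bdd_belowI[of _ "- p (- x)"]) auto
  have le: "q\<^sub>0 x \<le> q x" if "q \<in> Q" for q x
    unfolding q\<^sub>0_def using bdd that by (intro cINF_lower) auto
  have ge: "c \<le> q\<^sub>0 x" if "\<And>q. q \<in> Q \<Longrightarrow> c \<le> q x" for c x
    unfolding q\<^sub>0_def using ne that by (intro cINF_greatest) auto
  have add: "q\<^sub>0 (x + y) \<le> q\<^sub>0 x + q\<^sub>0 y" for x y
  proof -
    have "q\<^sub>0 (x + y) - q2 y \<le> q1 x" if q12: "q1 \<in> Q" "q2 \<in> Q" for q1 q2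
    proof -
      obtain q where q: "q \<in> Q" "q \<le> q1" "q \<le> q2" using chain[OF q12] q12 by blast
      have "q\<^sub>0 (x + y) \<le> q (x + y)" by (rule le) fact
      also have "\<dots> \<le> q x + q y" using sub q unfolding sublinear_functional_def by blast
      also have "\<dots> \<le> q1 x + q2 y" using q by (intro add_mono) (auto simp: le_fun_def)
      finally show ?thesis by simp
    qed
    then have "q\<^sub>0 (x + y) - q2 y \<le> q\<^sub>0 x" if "q2 \<in> Q" for q2 using that by (intro ge) auto
    then have "q\<^sub>0 (x + y) - q\<^sub>0 x \<le> q2 y" if "q2 \<in> Q" for q2 using that by force
    then have "q\<^sub>0 (x + y) - q\<^sub>0 x \<le> q\<^sub>0 y" by (intro ge) auto
    then show ?thesis by simp
  qed
  have scal: "q\<^sub>0 (s t x) = t * q\<^sub>0 x" if "t > 0" for t x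
  proof (rule antisym)
    have hom: "q (s t x) = t * q x" if "q \<in> Q" for q
      using that sub \<open>t > 0\<close> unfolding sublinear_functional_def by blast
    have "q\<^sub>0 (s t x) / t \<le> q\<^sub>0 x"
    proof (rule ge)
      fix q assume "q \<in> Q"
      then show "q\<^sub>0 (s t x) / t \<le> q x"
        using le[of q "s t x"] hom[of q] that by (simp add: divide_le_eq mult.commute)
    qed
    then show "q\<^sub>0 (s t x) \<le> t * q\<^sub>0 x" using that by (simp add: divide_le_eq mult.commute)
    show "t * q\<^sub>0 x \<le> q\<^sub>0 (s t x)" using that by (intro ge) (simp add: hom le)
  qed
  show ?thesis using add scal le unfolding sublinear_functional_def le_fun_def by blast
qed

text \<open>The modification that shows minimal sublinear functionals to be additive.\<close>

lemma sublinear_functional_shift: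
  assumes vs: "vector_space s" and q: "sublinear_functional s q"
  shows "\<exists>q'. sublinear_functional s q' \<and> q' \<le> q \<and> (\<forall>x t. t \<ge> 0 \<longrightarrow> q' x \<le> q (x + s t y) - t * q y)"
proof -
  interpret vector_space s by fact
  \<comment> \<open>The value at \<open>t = 0\<close> gives \<open>q' \<le> q\<close>; the value at
    \<open>t = 1\<close> turns minimality of \<open>q\<close> into
    \<open>q x \<le> q (x + y) - q y\<close>.\<close>
  define q' where "q' x = (INF t\<in>{0..}. q (x + s t y) - t * q y)" for x
  have add: "q (x + z) \<le> q x + q z" for x z using q unfolding sublinear_functional_def by blast
  have hom: "q (s t x) = t * q x" if "t \<ge> 0" for t x
    using q that sublinear_functional_zero[OF vs q] unfolding sublinear_functional_def
    by (cases "t = 0") auto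
  have lb: "- q (- x) \<le> q (x + s t y) - t * q y" if "t \<ge> 0" for t x
    using add[of "x + s t y" "- x"] hom[OF that] by simp
  have le: "q' x \<le> q (x + s t y) - t * q y" if "t \<ge> 0" for x t
    unfolding q'_def using that lb by (intro cINF_lower bdd_belowI[of _ "- q (- x)"]) auto
  have ge: "c \<le> q' x" if "\<And>t. t \<ge> 0 \<Longrightarrow> c \<le> q (x + s t y) - t * q y" for c x
    unfolding q'_def using that by (intro cINF_greatest) auto
  have "q' \<le> q" using le[of 0] by (simp add: le_fun_def)
  moreover have "q' (x + z) \<le> q' x + q' z" for x z
  proof -
    have "q' (x + z) - (q (z + s r y) - r * q y) \<le> q (x + s t y) - t * q y" if "t \<ge> 0" "r \<ge> 0" for t r
    proof -
      have "q' (x + z) \<le> q (x + z + s (t + r) y) - (t + r) * q y" using that by (intro le) auto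
      also have "x + z + s (t + r) y = (x + s t y) + (z + s r y)" by (simp add: algebra_simps)
      also have "q \<dots> \<le> q (x + s t y) + q (z + s r y)" by (rule add)
      finally show ?thesis by (simp add: algebra_simps)
    qed
    then have "q' (x + z) - (q (z + s r y) - r * q y) \<le> q' x" if "r \<ge> 0" for r
      using that by (intro ge) auto
    then have "q' (x + z) - q' x \<le> q (z + s r y) - r * q y" if "r \<ge> 0" for r
      using that by force
    then have "q' (x + z) - q' x \<le> q' z" by (intro ge) auto
    then show ?thesis by simp
  qed
  moreover have "q' (s u x) = u * q' x" if "u > 0" for u x
  proof (rule antisym)
    have eq: "q (s u x + s (u * t) y) - (u * t) * q y = u * (q (x + s t y) - t * q y)" for t
    proof -
      have "s u x + s (u * t) y = s u (x + s t y)" by (simp add: scale_right_distrib)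
      then show ?thesis using hom[of u] that by (simp add: right_diff_distrib mult.assoc)
    qed
    have "q' (s u x) / u \<le> q' x"
    proof (rule ge)
      fix t :: real assume "t \<ge> 0"
      then show "q' (s u x) / u \<le> q (x + s t y) - t * q y"
        using le[of "u * t" "s u x"] eq[of t] that by (simp add: divide_le_eq mult.commute)
    qed
    then show "q' (s u x) \<le> u * q' x" using that by (simp add: divide_le_eq mult.commute)
    show "u * q' x \<le> q' (s u x)"
    proof (rule ge)
      fix t :: real assume "t \<ge> 0"
      then have "u * q' x \<le> u * (q (x + s (t / u) y) - (t / u) * q y)"
        using that le[of "t / u" x] by (intro mult_left_mono) auto
      then show "u * q' x \<le> q (s u x + s t y) - t * q y"
        using eq[of "t / u"] that by simp
    qed
  qed
  ultimately show ?thesis using le unfolding sublinear_functional_def by blast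
qed

text \<open>A minimal sublinear functional is linear. To obtain equality at
  \<open>x\<^sub>0\<close>, \<open>p\<close> is first shifted in the direction
  \<open>x\<^sub>0\<close>: everything below the shifted functional \<open>p'\<close> satisfies
  \<open>f (- x\<^sub>0) \<le> - p x\<^sub>0\<close>.\<close>

lemma Hahn_Banach_sublinear:
  fixes s :: "real \<Rightarrow> 'a::ab_group_add \<Rightarrow> 'a"
  assumes vs: "vector_space s" and p: "sublinear_functional s p"
  shows "\<exists>f. Vector_Spaces.linear s (*) f \<and> f \<le> p \<and> f x\<^sub>0 = p x\<^sub>0"
proof -
  interpret vector_space s by fact
  obtain p' where p': "sublinear_functional s p'" "p' \<le> p"
    and p'x: "\<And>x t. t \<ge> 0 \<Longrightarrow> p' x \<le> p (x + s t x\<^sub>0) - t * p x\<^sub>0"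
    using sublinear_functional_shift[OF assms] by blast
  define A where "A = {q. sublinear_functional s q \<and> q \<le> p'}"
  \<comment> \<open>The order is reversed, so that Zorn's lemma yields a minimal element.\<close>
  have "\<exists>m\<in>A. \<forall>a\<in>A. a \<le> m \<longrightarrow> a = m"
  proof (rule predicate_Zorn)
    show "partial_order_on A (relation_of (\<lambda>x y. y \<le> x) A)"
      by (rule partial_order_on_relation_ofI) auto
    fix C assume C: "C \<in> Chains (relation_of (\<lambda>x y. y \<le> x) A)"
    show "\<exists>u\<in>A. \<forall>a\<in>C. u \<le> a"
    proof (cases "C = {}")
      case True
      then show ?thesis using p' unfolding A_def by auto
    next
      case False
      have CA: "a \<in> A" if "a \<in> C" for a
        using that C unfolding Chains_def relation_of_def by auto
      have "\<exists>q. sublinear_functional s q \<and> (\<forall>a\<in>C. q \<le> a)"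
      proof (rule sublinear_functional_Inf_chain[OF vs False])
        show "sublinear_functional s a \<and> a \<le> p'" if "a \<in> C" for a
          using CA[OF that] by (simp add: A_def)
        show "a \<le> b \<or> b \<le> a" if "a \<in> C" "b \<in> C" for a b
          using that C unfolding Chains_def relation_of_def by auto
      qed
      then obtain q where q: "sublinear_functional s q" "\<forall>a\<in>C. q \<le> a" by blast
      obtain a where "a \<in> C" using False by blast
      then have "q \<le> a" "a \<le> p'" using q CA by (auto simp: A_def)
      then show ?thesis using q unfolding A_def by (auto intro: order_trans[of q a])
    qed
  qed
  then obtain f where "f \<in> A" and min_A: "\<And>q. q \<in> A \<Longrightarrow> q \<le> f \<Longrightarrow> q = f" by blast
  then have f: "sublinear_functional s f" "f \<le> p'" by (auto simp: A_def)
  have min: "q = f" if "sublinear_functional s q" "q \<le> f" for q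
    using that order_trans[OF that(2) f(2)] by (intro min_A) (auto simp: A_def)
  have f_le: "f x \<le> p' x" "f x \<le> p x" for x
    using f(2) order_trans[OF f(2) p'(2)] by (auto simp: le_fun_def)
  have hom: "f (s t x) = t * f x" if "t > 0" for t x
    using f that unfolding sublinear_functional_def by blast
  have add: "f (x + y) = f x + f y" for x y
  proof (rule antisym)
    show "f (x + y) \<le> f x + f y" using f unfolding sublinear_functional_def by blast
    obtain q where "sublinear_functional s q" "q \<le> f"
      and q: "\<And>x t. t \<ge> 0 \<Longrightarrow> q x \<le> f (x + s t y) - t * f y"
      using sublinear_functional_shift[OF vs f(1)] by blast
    then have "q = f" by (intro min)
    then show "f x + f y \<le> f (x + y)" using q[of 1 x] by simp
  qed
  have f0: "f 0 = 0" using sublinear_functional_zero[OF vs f(1)] .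
  have neg: "f (- x) = - f x" for x using add[of x "- x"] f0 by simp
  have "f (s t x) = t * f x" for t x
  proof (cases "t > 0")
    case False
    then consider "t = 0" | "- t > 0" by linarith
    then show ?thesis
    proof cases
      case 2
      then have "f (s (- t) x) = - t * f x" by (rule hom)
      then show ?thesis using neg by simp
    qed (use f0 in simp)
  qed (use hom in simp)
  moreover have "f x\<^sub>0 = p x\<^sub>0"
  proof (rule antisym)
    show "f x\<^sub>0 \<le> p x\<^sub>0" by (rule f_le)
    have "f (- x\<^sub>0) \<le> p (- x\<^sub>0 + s 1 x\<^sub>0) - 1 * p x\<^sub>0"
      by (rule order_trans[OF f_le(1) p'x]) simp
    then show "p x\<^sub>0 \<le> f x\<^sub>0" using neg sublinear_functional_zero[OF assms] by simp
  qed
  ultimately show ?thesis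
    using add f_le(2) unfolding linear_functional_iff le_fun_def by blast
qed

section \<open>Functionals attaining a seminorm, over the reals and over the complex numbers\<close>

definition seminorm_on :: "('k::real_normed_field \<Rightarrow> 'a::ab_group_add \<Rightarrow> 'a) \<Rightarrow> ('a \<Rightarrow> real) \<Rightarrow> bool" where
  "seminorm_on s p \<longleftrightarrow> (\<forall>x y. p (x + y) \<le> p x + p y) \<and> (\<forall>c x. p (s c x) = norm c * p x)"

text \<open>Isolates the one ingredient whose proof differs for real and complex scalars; everything
  later takes it as a hypothesis and treats both fields at once.\<close>

definition norming_functionals_exist :: "('k::real_normed_field \<Rightarrow> 'a::ab_group_add \<Rightarrow> 'a) \<Rightarrow> bool" where
  "norming_functionals_exist s \<longleftrightarrow>
     (\<forall>p x\<^sub>0. seminorm_on s p \<longrightarrow>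
        (\<exists>f. Vector_Spaces.linear s (*) f \<and> (\<forall>x. norm (f x) \<le> p x) \<and> norm (f x\<^sub>0) = p x\<^sub>0))"

lemma seminorm_on_simps:
  assumes "vector_space s" "seminorm_on s p"
  shows seminorm_on_zero: "p 0 = 0" and seminorm_on_minus: "p (- x) = p x"
    and seminorm_on_nonneg: "p x \<ge> 0"
proof -
  interpret vector_space s by fact
  have add: "p (x + y) \<le> p x + p y" and scal: "p (s c x) = norm c * p x" for c x y
    using assms(2) unfolding seminorm_on_def by blast+
  show p0: "p 0 = 0" using scal[of 0 0] by simp
  show "p (- x) = p x" using scal[of "- 1" x] by simp
  then show "p x \<ge> 0" using add[of x "- x"] p0 by simp
qed

lemma norming_functionals_exist_real:
  fixes s :: "real \<Rightarrow> 'a::ab_group_add \<Rightarrow> 'a"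
  assumes vs: "vector_space s"
  shows "norming_functionals_exist s"
  unfolding norming_functionals_exist_def
proof (intro allI impI)
  fix p x\<^sub>0 assume p: "seminorm_on s p"
  interpret vector_space s by fact
  have "sublinear_functional s p" using p unfolding seminorm_on_def sublinear_functional_def by simp
  then obtain f where f: "Vector_Spaces.linear s (*) f" "f \<le> p" "f x\<^sub>0 = p x\<^sub>0"
    using Hahn_Banach_sublinear[OF vs] by blast
  have "norm (f x) \<le> p x" for x
  proof -
    have "f (s (- 1) x) = - 1 * f x" using f(1) linear_functional_iff by blast
    then have "f (- x) = - f x" by simp
    moreover have "f x \<le> p x" "f (- x) \<le> p (- x)" using f(2) by (auto simp: le_fun_def)
    moreover have "p (- x) = p x" by (rule seminorm_on_minus[OF vs p])
    ultimately show ?thesis by simp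
  qed
  then show "\<exists>f. Vector_Spaces.linear s (*) f \<and> (\<forall>x. norm (f x) \<le> p x) \<and> norm (f x\<^sub>0) = p x\<^sub>0"
    using f seminorm_on_nonneg[OF vs p, of x\<^sub>0] by auto
qed

text \<open>A real functional \<open>g\<close> below \<open>p\<close> is complexified to g(x) - i
  g(ix). Multiplying \<open>x\<close> by a scalar \<open>c\<close> of modulus 1 that makes
  \<open>f (s c x)\<close> real and positive reduces the bound on \<open>norm (f x)\<close> to the
  one on \<open>g\<close>.\<close>

lemma norming_functionals_exist_complex:
  fixes s :: "complex \<Rightarrow> 'a::ab_group_add \<Rightarrow> 'a"
  assumes vs: "vector_space s"
  shows "norming_functionals_exist s"
  unfolding norming_functionals_exist_def
proof (intro allI impI)
  fix p x\<^sub>0 assume p: "seminorm_on s p"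
  interpret vector_space s by fact
  define r where "r t = s (complex_of_real t)" for t
  have vr: "vector_space r" unfolding r_def by unfold_locales (auto simp: algebra_simps)
  then interpret R: vector_space r .
  have "sublinear_functional r p"
    using p unfolding seminorm_on_def sublinear_functional_def r_def by simp
  then obtain g where g: "Vector_Spaces.linear r (*) g" "g \<le> p" "g x\<^sub>0 = p x\<^sub>0"
    using Hahn_Banach_sublinear[OF vr] by blast
  have g_add: "g (x + y) = g x + g y" for x y using g(1) R.linear_functional_iff by blast
  have g_scale: "g (s (complex_of_real t) x) = t * g x" for t x
    using g(1) R.linear_functional_iff unfolding r_def by blast
  define f where "f x = Complex (g x) (- g (s \<i> x))" for x
  have f_add: "f (x + y) = f x + f y" for x y
    by (simp add: f_def g_add scale_right_distrib complex_eq_iff)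
  have f_scale: "f (s c x) = c * f x" for c x
  proof -
    have *: "g (s c x) = Re c * g x + Im c * g (s \<i> x)" for c x
    proof -
      have "s c x = s (complex_of_real (Re c)) x + s (complex_of_real (Im c)) (s \<i> x)"
        by (simp add: scale_left_distrib[symmetric] mult.commute complex_eq[symmetric])
      then show ?thesis by (simp only: g_add g_scale)
    qed
    have "g (s \<i> (s c x)) = Re c * g (s \<i> x) - Im c * g x"
      using *[of "\<i> * c" x] by (simp add: scale_scale)
    then show ?thesis using *[of c x] by (simp add: f_def complex_eq_iff)
  qed
  have lin: "Vector_Spaces.linear s (*) f" using f_add f_scale linear_functional_iff by blast
  have bd: "norm (f x) \<le> p x" for x
  proof (cases "f x = 0")
    case True
    then show ?thesis using seminorm_on_nonneg[OF vs p] by simp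
  next
    case False
    define c where "c = complex_of_real (norm (f x)) / f x"
    have "norm (f x) = Re (f (s c x))" using False by (simp add: f_scale c_def)
    also have "\<dots> = g (s c x)" by (simp add: f_def)
    also have "\<dots> \<le> p (s c x)" using g(2) by (simp add: le_fun_def)
    also have "\<dots> = p x" using p False unfolding seminorm_on_def by (simp add: c_def norm_divide)
    finally show ?thesis .
  qed
  have "p x\<^sub>0 \<le> norm (f x\<^sub>0)" using g(3) complex_Re_le_cmod[of "f x\<^sub>0"] by (simp add: f_def)
  then show "\<exists>f. Vector_Spaces.linear s (*) f \<and> (\<forall>x. norm (f x) \<le> p x) \<and> norm (f x\<^sub>0) = p x\<^sub>0"
    using lin bd by (metis antisym)
qed

section \<open>Spaces whose topology is not weak\<close>

lemma generate_topology_Inter: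
  assumes "finite I" "\<And>i. i \<in> I \<Longrightarrow> generate_topology B (S i)"
  shows "generate_topology B (\<Inter>i\<in>I. S i)"
  using assms by induction (auto intro: generate_topology.intros)

lemma seminorm_on_diff_le:
  assumes "vector_space s" "seminorm_on s p"
  shows "\<bar>p x - p y\<bar> \<le> p (x - y)"
proof -
  have add: "p (x + y) \<le> p x + p y" for x y using assms(2) unfolding seminorm_on_def by blast
  have "p (x - y) = p (y - x)" using seminorm_on_minus[OF assms, of "x - y"] by simp
  then show ?thesis using add[of "x - y" y] add[of "y - x" x] by simp
qed

context locally_convex_space
begin

section \<open>Continuous seminorms and the Minkowski gauge\<close>

lemma continuous_on_scale:
  assumes "continuous_on A f" "continuous_on A g"
  shows "continuous_on A (\<lambda>z. smul (f z) (g z))"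
proof -
  have "continuous_on A (\<lambda>z. (\<lambda>(c, x). smul c x) (f z, g z))"
    using assms by (intro continuous_on_compose2[OF continuous_scale]) (auto intro!: continuous_intros)
  then show ?thesis by simp
qed

lemma tendsto_scale:
  assumes "(f \<longlongrightarrow> c) F" "(g \<longlongrightarrow> x) F"
  shows "((\<lambda>z. smul (f z) (g z)) \<longlongrightarrow> smul c x) F"
proof -
  have "isCont (\<lambda>(c, x). smul c x) (c, x)"
    using continuous_scale by (simp add: continuous_on_eq_continuous_at)
  from isCont_tendsto_compose[OF this tendsto_Pair[OF assms]] show ?thesis by simp
qed

lemma continuous_seminorm:
  assumes p: "seminorm_on smul p" and V: "open V" "0 \<in> V" and K: "\<And>x. x \<in> V \<Longrightarrow> p x \<le> K"
  shows "continuous_on UNIV p"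
  unfolding continuous_on_def
proof (intro ballI tendstoI)
  fix x and e :: real assume e: "e > 0"
  note vs = vector_space_axioms
  have K0: "K \<ge> 0" using K[OF V(2)] seminorm_on_zero[OF vs p] by simp
  \<comment> \<open>Scaling by this \<open>c\<close> turns the bound \<open>K\<close> on
    \<open>V\<close> into \<open>e * (K / (K + 1))\<close>, which stays strictly below
    \<open>e\<close> and makes sense also for \<open>K = 0\<close>.\<close>
  define c :: 'k where "c = of_real ((K + 1) / e)"
  have c: "norm c = (K + 1) / e" using K0 e by (simp add: c_def norm_divide)
  let ?W = "(\<lambda>y. smul c (y - x)) -` V"
  have "open ?W" using V by (intro open_vimage continuous_on_scale continuous_intros)
  moreover have "x \<in> ?W" using V by simp
  moreover have "dist (p y) (p x) < e" if "y \<in> ?W" for y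
  proof -
    have "p (smul c (y - x)) \<le> K" using K that by simp
    then have "(K + 1) / e * p (y - x) \<le> K" using p c unfolding seminorm_on_def by simp
    then have "p (y - x) \<le> e * (K / (K + 1))" using K0 e by (simp add: field_simps)
    also have "\<dots> < e * 1" using K0 e by (intro mult_strict_left_mono) auto
    finally show ?thesis using seminorm_on_diff_le[OF vs p, of y x] by (simp add: dist_real_def)
  qed
  ultimately have "eventually (\<lambda>y. dist (p y) (p x) < e) (nhds x)"
    unfolding eventually_nhds by blast
  then show "eventually (\<lambda>y. dist (p y) (p x) < e) (at x within UNIV)"
    by (rule filter_leD[OF at_le[of UNIV UNIV x, THEN order_trans[OF _ at_within_le_nhds]], rotated]) simp
qed

text \<open>\<open>p\<close> is the Minkowski functional of the balanced core \<open>B\<close> of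
  \<open>C\<close>. Passing to \<open>B\<close> gives homogeneity for all scalars, since
  \<open>C\<close> need not be balanced; convexity survives, and joint continuity of scaling at (0,
  0) shows that \<open>B\<close> still contains a multiple of a neighbourhood \<open>V\<close> of
  0.\<close>

lemma gauge_seminorm:
  assumes C: "convex_over smul C" and C0: "0 \<in> interior C"
  shows "\<exists>p. seminorm_on smul p \<and> continuous_on UNIV p \<and> {x. p x < 1} \<subseteq> C"
proof -
  note vs = vector_space_axioms
  define B where "B = {x. \<forall>c. norm c \<le> 1 \<longrightarrow> smul c x \<in> C}"
  have BC: "B \<subseteq> C" unfolding B_def by (auto dest: spec[of _ 1])
  have bal: "smul c x \<in> B" if "x \<in> B" "norm c \<le> 1" for c x
    using that unfolding B_def by (simp add: norm_mult mult_le_one)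
  have conv: "smul (of_real u) x + smul (of_real v) y \<in> B"
    if "x \<in> B" "y \<in> B" "u \<ge> 0" "v \<ge> 0" "u + v = 1" for x y u v
    unfolding B_def
  proof (intro CollectI allI impI)
    fix c :: 'k assume "norm c \<le> 1"
    then have "smul (of_real u) (smul c x) + smul (of_real v) (smul c y) \<in> C"
      using that C unfolding B_def convex_over_def by blast
    then show "smul c (smul (of_real u) x + smul (of_real v) y) \<in> C"
      by (simp add: scale_right_distrib mult.commute)
  qed
  have "open ((\<lambda>(c, x). smul c x) -` interior C)" using continuous_scale by (intro open_vimage) auto
  moreover have "(0, 0) \<in> (\<lambda>(c, x). smul c x) -` interior C" using C0 by simp
  ultimately obtain A V where AV: "open A" "open V" "0 \<in> A" "0 \<in> V"
    "A \<times> V \<subseteq> (\<lambda>(c, x). smul c x) -` interior C"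
    by (auto elim!: open_prod_elim)
  obtain d where d: "d > 0" "ball 0 d \<subseteq> A" using AV(1,3) open_contains_ball by blast
  have VB: "smul (of_real (d / 2)) x \<in> B" if "x \<in> V" for x
    unfolding B_def
  proof (intro CollectI allI impI)
    fix c :: 'k assume c: "norm c \<le> 1"
    have "norm (c * of_real (d / 2)) = norm c * (d / 2)" using d(1) by (simp add: norm_mult)
    also have "\<dots> \<le> d / 2" using c d(1) by (simp add: mult_le_cancel_right1)
    also have "\<dots> < d" using d(1) by simp
    finally have "c * of_real (d / 2) \<in> A" using d(2) by (auto simp: dist_norm)
    then have "smul (c * of_real (d / 2)) x \<in> interior C" using AV(5) that by auto
    then show "smul c (smul (of_real (d / 2)) x) \<in> C" using interior_subset by auto
  qed
  define S where "S x = {t::real. t > 0 \<and> smul (of_real (1 / t)) x \<in> B}" for x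
  define p where "p x = Inf (S x)" for x
  have bdd: "bdd_below (S x)" for x by (intro bdd_belowI[of _ 0]) (auto simp: S_def)
  have le: "p x \<le> t" if "t \<in> S x" for t x
    unfolding p_def using bdd that by (rule cInf_lower[rotated])
  have V_S: "2 / d \<in> S x" if "x \<in> V" for x using VB[OF that] d(1) by (simp add: S_def)
  \<comment> \<open>\<open>B\<close> is absorbing: \<open>x / t\<close> tends to 0 and so enters
    \<open>V\<close>, a multiple of which lies in \<open>B\<close>.\<close>
  have ne: "S x \<noteq> {}" for x
  proof -
    have "((\<lambda>t. smul (of_real (1 / t)) x) \<longlongrightarrow> smul (of_real 0) x) at_top"
      by (intro tendsto_scale tendsto_of_real tendsto_const tendsto_divide_0[OF tendsto_const]
          filterlim_at_top_imp_at_infinity filterlim_ident)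
    then have "eventually (\<lambda>t::real. smul (of_real (1 / t)) x \<in> V) at_top"
      using AV(2,4) by (intro topological_tendstoD) auto
    then have "eventually (\<lambda>t::real. smul (of_real (1 / t)) x \<in> V \<and> t > 0) at_top"
      using eventually_gt_at_top by (intro eventually_conj)
    then obtain t :: real where t: "smul (of_real (1 / t)) x \<in> V" "t > 0"
      using eventually_happens'[OF trivial_limit_at_top_linorder] by blast
    then have "smul (of_real (d / 2 * (1 / t))) x \<in> B" using VB[OF t(1)] by simp
    moreover have "1 / (2 * t / d) = d / 2 * (1 / t)" by simp
    ultimately have "2 * t / d \<in> S x" using t(2) d(1) unfolding S_def by (metis (no_types, lifting) divide_pos_pos mem_Collect_eq mult_pos_pos zero_less_numeral)
    then show ?thesis by blast
  qed
  have ge: "c \<le> p x" if "\<And>t. t \<in> S x \<Longrightarrow> c \<le> t" for c x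
    unfolding p_def using ne that by (rule cInf_greatest)
  have add: "p (x + y) \<le> p x + p y" for x y
  proof -
    have "p (x + y) - r \<le> t" if t: "t \<in> S x" and r: "r \<in> S y" for t r
    proof -
      have tr: "t > 0" "r > 0" using t r by (auto simp: S_def)
      have "smul (of_real (t / (t + r))) (smul (of_real (1 / t)) x)
          + smul (of_real (r / (t + r))) (smul (of_real (1 / r)) y) \<in> B"
        using t r tr by (intro conv) (auto simp: S_def add_divide_distrib[symmetric])
      also have "smul (of_real (t / (t + r))) (smul (of_real (1 / t)) x)
          + smul (of_real (r / (t + r))) (smul (of_real (1 / r)) y) = smul (of_real (1 / (t + r))) (x + y)"
        using tr by (simp add: scale_right_distrib)
      finally have "t + r \<in> S (x + y)" using tr by (simp add: S_def)
      then show ?thesis using le by force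
    qed
    then have "p (x + y) - r \<le> p x" if "r \<in> S y" for r using that by (intro ge) auto
    then have "p (x + y) - p x \<le> r" if "r \<in> S y" for r using that by force
    then have "p (x + y) - p x \<le> p y" by (intro ge) auto
    then show ?thesis by simp
  qed
  have scale_le: "p (smul c x) \<le> norm c * p x" if c: "c \<noteq> 0" for c x
  proof -
    have "p (smul c x) / norm c \<le> t" if t: "t \<in> S x" for t
    proof -
      have "t > 0" using t by (simp add: S_def)
      have "smul (c / of_real (norm c)) (smul (of_real (1 / t)) x) \<in> B"
        by (rule bal) (use t c in \<open>simp_all add: S_def norm_divide\<close>)
      also have "smul (c / of_real (norm c)) (smul (of_real (1 / t)) x)
          = smul (of_real (1 / (norm c * t))) (smul c x)"
        by (simp add: mult.commute)
      finally have "norm c * t \<in> S (smul c x)"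
        using c \<open>t > 0\<close> by (simp add: S_def)
      then show ?thesis using le c by (simp add: divide_le_eq mult.commute)
    qed
    then have "p (smul c x) / norm c \<le> p x" by (rule ge)
    then show ?thesis using c by (simp add: divide_le_eq mult.commute)
  qed
  have scal: "p (smul c x) = norm c * p x" for c x
  proof (cases "c = 0")
    case True
    have "0 \<in> B" using C0 interior_subset by (auto simp: B_def)
    then have "p 0 \<le> t" if "t > 0" for t using that by (intro le) (simp add: S_def)
    then have "p 0 \<le> 0" by (metis dense not_le)
    moreover have "p 0 \<ge> 0" by (intro ge) (auto simp: S_def)
    ultimately show ?thesis using True by simp
  next
    case False
    have "p x = p (smul (inverse c) (smul c x))" using False by simp
    also have "\<dots> \<le> norm (inverse c) * p (smul c x)" using False by (intro scale_le) simp
    finally have "norm c * p x \<le> p (smul c x)" using False by (simp add: norm_divide field_simps)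
    then show ?thesis using scale_le[OF False, of x] by simp
  qed
  have semi: "seminorm_on smul p" using add scal unfolding seminorm_on_def by blast
  moreover have "continuous_on UNIV p"
    using semi AV(2,4) le[OF V_S] by (rule continuous_seminorm)
  moreover have "x \<in> C" if px: "p x < 1" for x
  proof -
    obtain t where t: "t \<in> S x" "t < 1"
      using cInf_lessD[OF ne px[unfolded p_def]] by blast
    have "smul (of_real t) (smul (of_real (1 / t)) x) \<in> B"
      by (rule bal) (use t in \<open>simp_all add: S_def\<close>)
    moreover have "t > 0" using t by (simp add: S_def)
    ultimately show ?thesis using BC by auto
  qed
  ultimately show ?thesis by blast
qed

lemma seminorm_nbhd:
  assumes "open U" "0 \<in> U"
  shows "\<exists>p. seminorm_on smul p \<and> continuous_on UNIV p \<and> {x. p x < 1} \<subseteq> U"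
  using locally_convex[OF assms] gauge_seminorm by (meson order_trans)

lemma continuous_on_linear_functional:
  fixes f :: "'a \<Rightarrow> 'k"
  assumes f: "Vector_Spaces.linear smul (*) f" and p: "continuous_on UNIV p" "seminorm_on smul p"
    and M: "\<And>x. norm (f x) \<le> M * p x"
  shows "continuous_on UNIV f"
  unfolding continuous_on_def
proof (intro ballI)
  fix x
  have diff: "f y - f x = f (y - x)" for y
    using linear_functional_diff[OF f] by simp
  have "continuous_on UNIV (\<lambda>y. M * p (y - x))"
    by (intro continuous_intros continuous_on_compose2[OF p(1)]) auto
  then have "((\<lambda>y. M * p (y - x)) \<longlongrightarrow> M * p (x - x)) (at x)"
    unfolding continuous_on_def by blast
  then have "((\<lambda>y. M * p (y - x)) \<longlongrightarrow> 0) (at x)"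
    using seminorm_on_zero[OF vector_space_axioms p(2)] by simp
  then have "((\<lambda>y. f y - f x) \<longlongrightarrow> 0) (at x)"
    by (rule Lim_null_comparison[rotated]) (simp add: diff M)
  then show "(f \<longlongrightarrow> f x) (at x within UNIV)" by (simp add: LIM_zero_iff)
qed

text \<open>
  The assumption on \<open>E\<close> makes the space of functionals bounded by a multiple of \<open>p\<close>
  finite-dimensional; \<open>F\<close> is a basis of it dual to a set \<open>G\<close> of minimal size.
\<close>

lemma seminorm_le_sum_functionals:
  fixes p :: "'a \<Rightarrow> real"
  assumes nf: "norming_functionals_exist smul" and p: "seminorm_on smul p"
    and E: "finite E"
    and E_sep: "\<not> (\<exists>f M. Vector_Spaces.linear smul (*) f \<and> (\<forall>x. norm (f x) \<le> M * p x) \<and>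
      (\<forall>e\<in>E. f e = 0) \<and> (\<exists>x. f x \<noteq> 0))"
  obtains G and F :: "'a \<Rightarrow> 'a \<Rightarrow> 'k" where "finite G"
    "\<And>e. e \<in> G \<Longrightarrow> Vector_Spaces.linear smul (*) (F e)"
    "\<And>e. e \<in> G \<Longrightarrow> \<exists>M. \<forall>x. norm (F e x) \<le> M * p x"
    "\<And>x. p x \<le> (\<Sum>e\<in>G. p e * norm (F e x))"
proof -
  note vs = vector_space_axioms
  define bd :: "('a \<Rightarrow> 'k) \<Rightarrow> bool"
    where "bd f \<longleftrightarrow> Vector_Spaces.linear smul (*) f \<and> (\<exists>M. \<forall>x. norm (f x) \<le> M * p x)" for f
  define P where "P E \<longleftrightarrow> finite E \<and> (\<forall>f. bd f \<longrightarrow> (\<forall>e\<in>E. f e = 0) \<longrightarrow> f = (\<lambda>x. 0))" for E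
  have "P E" using E E_sep unfolding P_def bd_def by blast
  then obtain G where G: "P G" and G_min: "\<And>E. P E \<Longrightarrow> card G \<le> card E"
    using ex_has_least_nat[of P E card] by blast
  have fin: "finite G" using G by (simp add: P_def)
  have bd_diff: "bd (\<lambda>x. f x - g x)" if f: "bd f" and g: "bd g" for f g
  proof -
    obtain M N where MN: "norm (f x) \<le> M * p x" "norm (g x) \<le> N * p x" for x
      using f g unfolding bd_def by blast
    have "norm (f x - g x) \<le> (M + N) * p x" for x
      using norm_triangle_ineq4[of "f x" "g x"] MN[of x] by (simp add: distrib_right)
    then have "\<exists>K. \<forall>x. norm (f x - g x) \<le> K * p x" by blast
    then show ?thesis using f g unfolding bd_def linear_functional_iff
      by (simp add: algebra_simps)
  qed
  have bd_mult: "bd (\<lambda>x. c * f x)" if f: "bd f" for c f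
  proof -
    obtain M where "norm (f x) \<le> M * p x" for x using f unfolding bd_def by blast
    then have "norm (c * f x) \<le> (norm c * M) * p x" for x
      by (simp add: norm_mult mult_left_mono mult.assoc)
    then have "\<exists>K. \<forall>x. norm (c * f x) \<le> K * p x" by blast
    then show ?thesis using f unfolding bd_def linear_functional_iff
      by (simp add: algebra_simps)
  qed
  have bd_0: "bd (\<lambda>x. 0)" unfolding bd_def linear_functional_iff
    by (auto intro!: exI[of _ 0])
  \<comment> \<open>By minimality of \<open>card G\<close>, omitting \<open>e\<close> admits a
    nonzero bounded functional vanishing on the rest of \<open>G\<close>. It cannot vanish at
    \<open>e\<close> as well, so it can be normalised there.\<close>
  have "\<exists>f. bd f \<and> f e = 1 \<and> (\<forall>e'\<in>G - {e}. f e' = 0)" if e: "e \<in> G" for e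
  proof -
    have "card (G - {e}) < card G" using fin e by (rule card_Diff1_less)
    then have "\<not> P (G - {e})" using G_min by fastforce
    then obtain f where f: "bd f" "\<forall>e'\<in>G - {e}. f e' = 0" "f \<noteq> (\<lambda>x. 0)"
      using fin unfolding P_def by auto
    have "f e \<noteq> 0" using f G unfolding P_def by blast
    then show ?thesis using f bd_mult[OF f(1), of "1 / f e"] by (intro exI[of _ "\<lambda>x. 1 / f e * f x"]) auto
  qed
  then obtain F where F: "\<And>e. e \<in> G \<Longrightarrow> bd (F e)" "\<And>e. e \<in> G \<Longrightarrow> F e e = 1"
    "\<And>e e'. e \<in> G \<Longrightarrow> e' \<in> G - {e} \<Longrightarrow> F e e' = 0"
    by metis
  \<comment> \<open>The difference of \<open>f\<close> and its expansion is bounded and vanishes on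
    \<open>G\<close>, hence is zero by \<open>P G\<close>.\<close>
  have rep: "f x = (\<Sum>e\<in>G. f e * F e x)" if f: "bd f" for f x
  proof -
    have "bd (\<lambda>x. \<Sum>e\<in>H. f e * F e x)" if "H \<subseteq> G" for H
      using finite_subset[OF that fin] that
    proof induction
      case (insert a H)
      have "bd (\<lambda>x. (\<Sum>e\<in>H. f e * F e x) - (- f a) * F a x)"
        using insert by (intro bd_diff bd_mult F) auto
      then show ?case using insert by (simp add: algebra_simps)
    qed (use bd_0 in simp)
    then have "bd (\<lambda>x. f x - (\<Sum>e\<in>G. f e * F e x))" using f by (intro bd_diff) auto
    moreover have "f e' - (\<Sum>e\<in>G. f e * F e e') = 0" if "e' \<in> G" for e'
    proof -
      have "(\<Sum>e\<in>G. f e * F e e') = (\<Sum>e\<in>G. if e = e' then f e' else 0)"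
        using F that by (intro sum.cong) auto
      then show ?thesis using fin that by simp
    qed
    ultimately have "(\<lambda>x. f x - (\<Sum>e\<in>G. f e * F e x)) = (\<lambda>x. 0)"
      using G unfolding P_def by blast
    from fun_cong[OF this, of x] show ?thesis by simp
  qed
  \<comment> \<open>A functional attaining \<open>p\<close> at this \<open>x\<close> is expanded;
    its coefficients satisfy \<open>norm (f e) \<le> p e\<close>.\<close>
  have "p x \<le> (\<Sum>e\<in>G. p e * norm (F e x))" for x
  proof -
    obtain f where f: "Vector_Spaces.linear smul (*) f" "\<And>x. norm (f x) \<le> p x" "norm (f x) = p x"
      using nf p unfolding norming_functionals_exist_def by blast
    have "bd f" using f(1,2) unfolding bd_def by (auto intro!: exI[of _ 1])
    from rep[OF this, of x] have "p x = norm (\<Sum>e\<in>G. f e * F e x)" using f(3) by simp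
    also have "\<dots> \<le> (\<Sum>e\<in>G. p e * norm (F e x))"
      using f(2) by (intro sum_norm_le) (simp add: norm_mult mult_right_mono)
    finally show ?thesis .
  qed
  then show ?thesis using fin F(1) unfolding bd_def by (intro that[of G F]) auto
qed

text \<open>Otherwise every continuous seminorm is dominated by a finite combination of moduli of
  continuous functionals, so the topology is \<sigma>(X, Y) with Y the continuous dual. That the
  dual separates points follows from the norming functionals.\<close>

lemma seminorm_with_many_functionals:
  assumes nf: "norming_functionals_exist smul" and nw: "\<not> has_weak_topology smul"
  shows "\<exists>p. seminorm_on smul p \<and> continuous_on UNIV p \<and>
    (\<forall>E. finite E \<longrightarrow> (\<exists>f M. Vector_Spaces.linear smul (*) f \<and> (\<forall>x. norm (f x :: 'k) \<le> M * p x) \<and>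
       (\<forall>e\<in>E. f e = 0) \<and> (\<exists>x. f x \<noteq> 0)))"
proof (rule ccontr)
  assume neg: "\<not> ?thesis"
  note vs = vector_space_axioms
  define Y where "Y = {f :: 'a \<Rightarrow> 'k. Vector_Spaces.linear smul (*) f \<and> continuous_on UNIV f}"
  have "\<exists>f\<in>Y. f x \<noteq> f y" if "x \<noteq> y" for x y
  proof -
    have "0 \<noteq> x - y" using that by simp
    from t1_space[OF this] obtain U where U: "open U" "0 \<in> U" "x - y \<notin> U" by blast
    obtain p where p: "seminorm_on smul p" "continuous_on UNIV p" "{x. p x < 1} \<subseteq> U"
      using seminorm_nbhd[OF U(1,2)] by blast
    obtain f where f: "Vector_Spaces.linear smul (*) f" "\<And>x. norm (f x) \<le> p x"
      "norm (f (x - y)) = p (x - y)"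
      using nf p unfolding norming_functionals_exist_def by blast
    have "f \<in> Y" using continuous_on_linear_functional[OF f(1) p(2,1), of 1] f by (auto simp: Y_def)
    moreover have "f (x - y) = f x - f y" using f(1) by (rule linear_functional_diff)
    moreover have "x - y \<notin> {x. p x < 1}" using p(3) U(3) by blast
    then have "p (x - y) \<noteq> 0" by auto
    ultimately show ?thesis using f(3) by (intro bexI[of _ f]) auto
  qed
  then have "separating_functional_space smul Y"
    unfolding separating_functional_space_def
    by (auto simp: Y_def linear_functional_iff algebra_simps intro!: continuous_intros)
  moreover have "open S \<longleftrightarrow> sigma_open Y S" for S
  proof
    assume "sigma_open Y S"
    then show "open S" unfolding sigma_open_def
    proof induction
      case (Basis s)
      then show ?case by (auto simp: Y_def intro: open_vimage)
    qed auto
  next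
    assume S: "open S"
    have "\<exists>G. sigma_open Y G \<and> x \<in> G \<and> G \<subseteq> S" if x: "x \<in> S" for x
    proof -
      have "open ((\<lambda>y. x + y) -` S)" by (intro open_vimage S continuous_intros)
      moreover have "0 \<in> (\<lambda>y. x + y) -` S" using x by simp
      ultimately obtain p where p: "seminorm_on smul p" "continuous_on UNIV p"
        "{y. p y < 1} \<subseteq> (\<lambda>y. x + y) -` S"
        using seminorm_nbhd by blast
      obtain E\<^sub>0 where E\<^sub>0: "finite E\<^sub>0"
        "\<not> (\<exists>f M. Vector_Spaces.linear smul (*) f \<and> (\<forall>x. norm (f x :: 'k) \<le> M * p x) \<and>
           (\<forall>e\<in>E\<^sub>0. f e = 0) \<and> (\<exists>x. f x \<noteq> 0))"
        using neg p(1,2) by blast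

      obtain E and F :: "'a \<Rightarrow> 'a \<Rightarrow> 'k" where fin: "finite E"
        and F: "\<And>e. e \<in> E \<Longrightarrow> Vector_Spaces.linear smul (*) (F e)"
          "\<And>e. e \<in> E \<Longrightarrow> \<exists>M. \<forall>x. norm (F e x) \<le> M * p x"
        and p_le: "\<And>x. p x \<le> (\<Sum>e\<in>E. p e * norm (F e x))"
        by (rule seminorm_le_sum_functionals[OF nf p(1) E\<^sub>0]) (rule that)
      have FY: "F e \<in> Y" if "e \<in> E" for e
        using continuous_on_linear_functional[OF F(1)[OF that] p(2,1)] F[OF that]
        unfolding Y_def by blast
      \<comment> \<open>With this radius the bound \<open>(\<Sum>e\<in>E. p e) * r\<close> is below
        1, also when the sum vanishes.\<close>
      define r where "r = 1 / (1 + (\<Sum>e\<in>E. p e))"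
      have s0: "(\<Sum>e\<in>E. p e) \<ge> 0" using seminorm_on_nonneg[OF vs p(1)] by (simp add: sum_nonneg)
      then have r: "r > 0" by (simp add: r_def)
      define G where "G = (\<Inter>e\<in>E. F e -` ball (F e x) r)"
      have "sigma_open Y G"
        unfolding sigma_open_def G_def using fin FY
        by (intro generate_topology_Inter generate_topology.Basis) auto
      moreover have "x \<in> G" using r by (simp add: G_def)
      moreover have "y \<in> S" if y: "y \<in> G" for y
      proof -
        have *: "norm (F e (y - x)) \<le> r" if e: "e \<in> E" for e
        proof -
          have "F e (y - x) = F e y - F e x"
            using F(1)[OF e] by (rule linear_functional_diff)
          then show ?thesis using y e by (force simp: G_def dist_norm norm_minus_commute)
        qed
        have "p (y - x) \<le> (\<Sum>e\<in>E. p e * norm (F e (y - x)))" by (rule p_le)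
        also have "\<dots> \<le> (\<Sum>e\<in>E. p e * r)"
          using * seminorm_on_nonneg[OF vs p(1)] by (intro sum_mono mult_left_mono) auto
        also have "\<dots> = (\<Sum>e\<in>E. p e) * r" by (simp add: sum_distrib_right)
        also have "\<dots> < 1" using s0 by (simp add: r_def)
        finally have "y - x \<in> {y. p y < 1}" by simp
        then show ?thesis using p(3) by fastforce
      qed
      ultimately show ?thesis by blast
    qed
    then have "\<forall>x\<in>S. \<exists>G. sigma_open Y G \<and> x \<in> G \<and> G \<subseteq> S" by blast
    from bchoice[OF this] obtain G
      where G: "\<And>x. x \<in> S \<Longrightarrow> sigma_open Y (G x) \<and> x \<in> G x \<and> G x \<subseteq> S" by blast
    then have "S = \<Union> (G ` S)" by blast
    moreover have "sigma_open Y (\<Union> (G ` S))"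
      using G unfolding sigma_open_def by (auto intro!: generate_topology.UN)
    ultimately show "sigma_open Y S" by simp
  qed
  ultimately show False using nw unfolding has_weak_topology_def by blast
qed

end

section \<open>The image of the unit ball of \<open>\<ell>\<^sub>1\<close>\<close>

text \<open>Completeness of \<ell>_1, with the sum computed coordinatewise: exchanging a finite sum
  over \<open>i\<close> with the series over \<open>j\<close> bounds every partial sum of the
  norms.\<close>

lemma ell1_series:
  fixes a :: "nat \<Rightarrow> nat \<Rightarrow> 'k::banach"
  assumes r: "summable r" and a: "\<And>j. summable (\<lambda>i. norm (a j i))" "\<And>j. (\<Sum>i. norm (a j i)) \<le> r j"
  shows "summable (\<lambda>j. a j i)" "summable (\<lambda>i. norm (\<Sum>j. a j i))"
    "(\<Sum>i. norm (\<Sum>j. a j i)) \<le> (\<Sum>j. r j)"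
proof -
  have norm_le: "norm (a j i) \<le> r j" for i j
    using sum_le_suminf[OF a(1)[of j], of "{i}"] a(2)[of j] by simp
  have sum_norm: "summable (\<lambda>j. norm (a j i))" for i
    by (rule summable_comparison_test'[OF r]) (simp add: norm_le)
  then show "summable (\<lambda>j. a j i)" for i by (rule summable_norm_cancel)
  have fin: "(\<Sum>i<n. norm (\<Sum>j. a j i)) \<le> (\<Sum>j. r j)" for n
  proof -
    have "(\<Sum>i<n. norm (\<Sum>j. a j i)) \<le> (\<Sum>i<n. \<Sum>j. norm (a j i))"
      by (intro sum_mono summable_norm sum_norm)
    also have "\<dots> = (\<Sum>j. \<Sum>i<n. norm (a j i))"
      using sum_norm by (simp add: suminf_sum)
    also have "\<dots> \<le> (\<Sum>j. r j)"
    proof (intro suminf_le summable_sum sum_norm r)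
      fix j
      show "(\<Sum>i<n. norm (a j i)) \<le> r j"
        using sum_le_suminf[OF a(1)[of j], of "{..<n}"] a(2)[of j] by simp
    qed
    finally show ?thesis .
  qed
  then show "summable (\<lambda>i. norm (\<Sum>j. a j i))"
    by (intro summableI_nonneg_bounded) auto
  then show "(\<Sum>i. norm (\<Sum>j. a j i)) \<le> (\<Sum>j. r j)"
    using fin by (intro suminf_le_const) auto
qed

text \<open>The sort \<open>euclidean_space\<close> covers both scalar fields and provides the
  completeness used in \<open>ell1_series\<close> and, later, a countable dense set of
  scalars.\<close>

locale ell1_disk = locally_convex_space smul
  for smul :: "'k::{real_normed_field, euclidean_space} \<Rightarrow> 'a::{topological_ab_group_add, t2_space} \<Rightarrow> 'a" +
  fixes y :: "nat \<Rightarrow> 'a"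
  assumes ell1: "ell1_sequence smul y"
begin

definition comb :: "(nat \<Rightarrow> 'k) \<Rightarrow> 'a" where
  "comb a = (\<Sum>i. smul (a i) (y i))"

text \<open>Says that the quotient norm of \<open>v\<close> on the image of \<ell>_1 under
  \<open>comb\<close> is at most \<open>r\<close>, with a representative that realises the bound.
  Keeping the radius as an argument replaces an infimum over representatives.\<close>

definition in_disk :: "real \<Rightarrow> 'a \<Rightarrow> bool" where
  "in_disk r v \<longleftrightarrow> (\<exists>a. summable (\<lambda>i. norm (a i)) \<and> (\<Sum>i. norm (a i)) \<le> r \<and> v = comb a)"

lemma summable_comb: "summable (\<lambda>i. norm (a i)) \<Longrightarrow> summable (\<lambda>i. smul (a i) (y i))"
  using ell1 unfolding ell1_sequence_def by blast

lemma comb_add: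
  assumes "summable (\<lambda>i. norm (a i))" "summable (\<lambda>i. norm (b i))"
  shows "comb (\<lambda>i. a i + b i) = comb a + comb b"
  unfolding comb_def using suminf_add[OF assms[THEN summable_comb]] by (simp add: scale_left_distrib)

lemma comb_scale:
  assumes "summable (\<lambda>i. norm (a i))"
  shows "comb (\<lambda>i. c * a i) = smul c (comb a)"
proof -
  have "(\<lambda>n. smul c (\<Sum>i<n. smul (a i) (y i))) \<longlonglongrightarrow> smul c (comb a)"
    unfolding comb_def using summable_LIMSEQ[OF summable_comb[OF assms]]
    by (intro tendsto_scale tendsto_const)
  then have "(\<lambda>i. smul (c * a i) (y i)) sums smul c (comb a)"
    by (simp add: sums_def scale_sum_right)
  then show ?thesis unfolding comb_def by (rule sums_unique[symmetric])
qed

lemma in_disk_nonneg: "in_disk r v \<Longrightarrow> r \<ge> 0"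
  unfolding in_disk_def by (meson norm_ge_zero order_trans suminf_nonneg)

lemma in_disk_mono: "in_disk r v \<Longrightarrow> r \<le> s \<Longrightarrow> in_disk s v"
  unfolding in_disk_def using order_trans by blast

lemma in_disk_add:
  assumes "in_disk r v" "in_disk s w"
  shows "in_disk (r + s) (v + w)"
proof -
  obtain a b where a: "summable (\<lambda>i. norm (a i))" "(\<Sum>i. norm (a i)) \<le> r" "v = comb a"
    and b: "summable (\<lambda>i. norm (b i))" "(\<Sum>i. norm (b i)) \<le> s" "w = comb b"
    using assms unfolding in_disk_def by blast
  have s: "summable (\<lambda>i. norm (a i) + norm (b i))" using a b by (intro summable_add)
  then have s': "summable (\<lambda>i. norm (a i + b i))"
    by (rule summable_comparison_test'[where N = 0]) (simp add: norm_triangle_ineq)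
  have "(\<Sum>i. norm (a i + b i)) \<le> (\<Sum>i. norm (a i) + norm (b i))"
    using s s' by (intro suminf_le) (simp_all add: norm_triangle_ineq)
  also have "\<dots> \<le> r + s" using a b by (simp add: suminf_add[symmetric])
  finally show ?thesis using s' a b comb_add unfolding in_disk_def by metis
qed

lemma in_disk_scale:
  assumes "in_disk r v"
  shows "in_disk (norm c * r) (smul c v)"
proof -
  obtain a where a: "summable (\<lambda>i. norm (a i))" "(\<Sum>i. norm (a i)) \<le> r" "v = comb a"
    using assms unfolding in_disk_def by blast
  have "summable (\<lambda>i. norm (c * a i))" using a(1) by (simp add: norm_mult summable_mult)
  moreover have "(\<Sum>i. norm (c * a i)) \<le> norm c * r"
    using a by (simp add: norm_mult suminf_mult mult_left_mono)
  ultimately show ?thesis using a comb_scale unfolding in_disk_def by metis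
qed

lemma in_disk_minus: "in_disk r v \<Longrightarrow> in_disk r (- v)"
  using in_disk_scale[of r v "- 1"] by simp

lemma in_disk_zero: "in_disk 0 0"
  unfolding in_disk_def by (intro exI[of _ "\<lambda>_. 0"]) (simp add: comb_def)

lemma in_disk_sum:
  assumes "finite A" "\<And>j. j \<in> A \<Longrightarrow> in_disk (r j) (v j)"
  shows "in_disk (\<Sum>j\<in>A. r j) (\<Sum>j\<in>A. v j)"
  using assms by induction (auto intro: in_disk_add in_disk_zero)

lemma in_disk_member: "in_disk 1 (y n)"
proof -
  have *: "(\<lambda>i. norm (if i = n then 1 else 0 :: 'k)) = (\<lambda>i. if i = n then 1 else 0)" by auto
  have "summable (\<lambda>i. norm (if i = n then 1 else 0 :: 'k))"
    "(\<Sum>i. norm (if i = n then 1 else 0 :: 'k)) \<le> 1"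
    unfolding * using sums_single[of n "\<lambda>_. 1::real"] by (auto simp: sums_iff)
  moreover have "comb (\<lambda>i. if i = n then 1 else 0) = y n"
  proof -
    have "(\<lambda>i. smul (if i = n then 1 else 0) (y i)) = (\<lambda>i. if i = n then y i else 0)" by auto
    then show ?thesis unfolding comb_def using sums_single[of n y] by (simp add: sums_iff)
  qed
  ultimately show ?thesis unfolding in_disk_def by metis
qed

text \<open>As \<open>y\<close> tends to 0, \<open>q\<close> is bounded on its terms; the triangle
  inequality handles the partial sums, and continuity of \<open>q\<close> the limit.\<close>

lemma seminorm_bounded_on_disk:
  assumes q: "seminorm_on smul q" "continuous_on UNIV q"
  shows "\<exists>K\<ge>0. \<forall>r v. in_disk r v \<longrightarrow> q v \<le> K * r"
proof -
  note vs = vector_space_axioms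
  have "y \<longlonglongrightarrow> 0" using ell1 unfolding ell1_sequence_def by blast
  then have "(\<lambda>n. q (y n)) \<longlonglongrightarrow> q 0"
    using q(2) by (auto intro: continuous_on_tendsto_compose)
  then have "Bseq (\<lambda>n. q (y n))" using convergentI convergent_imp_Bseq by blast
  then obtain K where K: "K > 0" "\<And>n. norm (q (y n)) \<le> K" unfolding Bseq_def by blast
  have q_sum: "q (\<Sum>i<n. v i) \<le> (\<Sum>i<n. q (v i))" for v and n :: nat
  proof (induction n)
    case (Suc n)
    have "q (sum v {..<n} + v n) \<le> q (sum v {..<n}) + q (v n)"
      using q(1) unfolding seminorm_on_def by blast
    then show ?case using Suc by simp
  qed (use seminorm_on_zero[OF vs q(1)] in simp)
  have "q v \<le> K * r" if v: "in_disk r v" for r v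
  proof -
    obtain a where a: "summable (\<lambda>i. norm (a i))" "(\<Sum>i. norm (a i)) \<le> r" "v = comb a"
      using v unfolding in_disk_def by blast
    have "(\<lambda>n. q (\<Sum>i<n. smul (a i) (y i))) \<longlonglongrightarrow> q v"
      using summable_LIMSEQ[OF summable_comb[OF a(1)]] q(2) unfolding a(3) comb_def
      by (auto intro: continuous_on_tendsto_compose)
    moreover have "q (\<Sum>i<n. smul (a i) (y i)) \<le> K * r" for n
    proof -
      have "q (\<Sum>i<n. smul (a i) (y i)) \<le> (\<Sum>i<n. norm (a i) * q (y i))"
        using q_sum[of "\<lambda>i. smul (a i) (y i)" n] q(1) unfolding seminorm_on_def by simp
      also have "\<dots> \<le> (\<Sum>i<n. norm (a i) * K)"
        using K(2) by (intro sum_mono mult_left_mono) (auto simp: abs_le_iff)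
      also have "\<dots> = K * (\<Sum>i<n. norm (a i))" by (simp add: sum_distrib_left mult.commute)
      also have "\<dots> \<le> K * r"
        using sum_le_suminf[OF a(1), of "{..<n}"] a(2) K(1) by (intro mult_left_mono) auto
      finally show ?thesis .
    qed
    ultimately show ?thesis by (intro LIMSEQ_le_const2) auto
  qed
  then show ?thesis using K(1) less_imp_le by blast
qed

text \<open>The quotient norm is finer than the topology of the space, so all later convergence
  arguments reduce to estimates of radii.\<close>

lemma in_disk_nbhd:
  assumes "open U" "0 \<in> U"
  shows "\<exists>d>0. \<forall>v. in_disk d v \<longrightarrow> v \<in> U"
proof -
  obtain q where q: "seminorm_on smul q" "continuous_on UNIV q" "{x. q x < 1} \<subseteq> U"
    using seminorm_nbhd[OF assms] by blast
  obtain K where K: "K \<ge> 0" "\<And>r v. in_disk r v \<Longrightarrow> q v \<le> K * r"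
    using seminorm_bounded_on_disk[OF q(1,2)] by blast
  have "v \<in> U" if v: "in_disk (1 / (K + 1)) v" for v
  proof -
    have "q v \<le> K * (1 / (K + 1))" using v by (rule K)
    also have "\<dots> < 1" using K(1) by simp
    finally show ?thesis using q(3) by blast
  qed
  then show ?thesis using K(1) by (intro exI[of _ "1 / (K + 1)"]) auto
qed

lemma in_disk_tendsto:
  assumes w: "\<And>n. in_disk (R n) (w n)" and R: "(R \<longlongrightarrow> 0) F"
  shows "(w \<longlongrightarrow> 0) F"
proof (rule topological_tendstoI)
  fix U :: "'a set" assume "open U" "0 \<in> U"
  then obtain d where d: "d > 0" "\<And>v. in_disk d v \<Longrightarrow> v \<in> U" using in_disk_nbhd by blast
  have "eventually (\<lambda>n. R n < d) F" using R d(1) by (rule order_tendstoD)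
  then show "eventually (\<lambda>n. w n \<in> U) F"
    by eventually_elim (use d(2) in_disk_mono[OF w] in fastforce)
qed

text \<open>The image of \<ell>_1 is complete for the quotient norm, which replaces completeness of
  the space itself: the representing sequences are summed coordinatewise by
  \<open>ell1_series\<close>.\<close>

lemma in_disk_suminf:
  assumes v: "\<And>j. in_disk (r j) (v j)" and r: "summable r"
  shows "summable v" "in_disk (\<Sum>j. r j) (\<Sum>j. v j)"
proof -
  obtain a where a: "\<And>j. summable (\<lambda>i. norm (a j i))" "\<And>j. (\<Sum>i. norm (a j i)) \<le> r j"
    "\<And>j. v j = comb (a j)"
    using v unfolding in_disk_def by metis
  note ser = ell1_series[OF r a(1,2)]
  define b where "b i = (\<Sum>j. a j i)" for i
  have b: "summable (\<lambda>i. norm (b i))" "(\<Sum>i. norm (b i)) \<le> (\<Sum>j. r j)"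
    using ser unfolding b_def by auto
  have diff: "summable (\<lambda>i. norm (b i - (\<Sum>j<n. a j i))) \<and>
    comb (\<lambda>i. b i - (\<Sum>j<n. a j i)) = comb b - (\<Sum>j<n. v j)" for n
  proof (induction n)
    case (Suc n)
    define c where "c i = b i - (\<Sum>j<n. a j i)" for i
    have c: "summable (\<lambda>i. norm (c i))" "comb c = comb b - (\<Sum>j<n. v j)"
      using Suc unfolding c_def by auto
    have an: "summable (\<lambda>i. norm (- 1 * a n i))" using a(1) by simp
    have eq: "b i - (\<Sum>j<Suc n. a j i) = c i + - 1 * a n i" for i by (simp add: c_def)
    have "summable (\<lambda>i. norm (c i + - 1 * a n i))"
      by (rule summable_comparison_test'[OF summable_add[OF c(1) an], where N = 0])
        (simp, metis norm_triangle_ineq4)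
    moreover have "comb (\<lambda>i. c i + - 1 * a n i) = comb b - (\<Sum>j<Suc n. v j)"
      using comb_add[OF c(1) an] comb_scale[OF a(1)[of n], of "- 1"] c(2) a(3)[of n]
      by (simp add: algebra_simps)
    ultimately show ?case unfolding eq by blast
  qed (use b in simp)
  \<comment> \<open>The remainder is represented by the sum of the sequences
    \<open>a (j + n)\<close>, so the tail of \<open>r\<close> is a radius for it.\<close>
  have "in_disk (\<Sum>j. r (j + n)) (comb b - (\<Sum>j<n. v j))" for n
  proof -
    have "b i - (\<Sum>j<n. a j i) = (\<Sum>j. a (j + n) i)" for i
      unfolding b_def by (rule suminf_minus_initial_segment[symmetric, OF ser(1)])
    then have "(\<Sum>i. norm (b i - (\<Sum>j<n. a j i))) \<le> (\<Sum>j. r (j + n))"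
      using ell1_series(3)[of "\<lambda>j. r (j + n)" "\<lambda>j. a (j + n)"] r a by (simp add: summable_iff_shift)
    then show ?thesis using diff[of n] unfolding in_disk_def by metis
  qed
  moreover have "(\<lambda>n. \<Sum>j. r (j + n)) \<longlonglongrightarrow> 0"
  proof -
    have "(\<lambda>n. (\<Sum>j. r j) - (\<Sum>j<n. r j)) \<longlonglongrightarrow> (\<Sum>j. r j) - (\<Sum>j. r j)"
      by (intro tendsto_intros summable_LIMSEQ r)
    then show ?thesis using suminf_minus_initial_segment[OF r] by simp
  qed
  ultimately have "(\<lambda>n. comb b - (\<Sum>j<n. v j)) \<longlonglongrightarrow> 0" by (rule in_disk_tendsto)
  then have "(\<lambda>n. comb b - (comb b - (\<Sum>j<n. v j))) \<longlonglongrightarrow> comb b - 0"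
    by (intro tendsto_diff tendsto_const)
  then have "v sums comb b" by (simp add: sums_def)
  then show "summable v" "in_disk (\<Sum>j. r j) (\<Sum>j. v j)"
    using b unfolding in_disk_def by (auto simp: sums_iff)
qed

end

section \<open>Biorthogonal systems\<close>

lemma (in vector_space) linear_functional_sum:
  assumes "Vector_Spaces.linear scale (*) f"
  shows "f (\<Sum>j\<in>A. scale (c j) (v j)) = (\<Sum>j\<in>A. c j * f (v j))"
proof -
  interpret f: Vector_Spaces.linear scale "(*)" f by fact
  show ?thesis by (simp add: f.sum f.scale)
qed

context locally_convex_space
begin

lemma subspace_closure:
  assumes S: "subspace S"
  shows "subspace (closure S)"
proof (rule subspaceI)
  show "0 \<in> closure S" using subspace_0[OF S] closure_subset by blast
  have "(\<lambda>(x, y). x + y) ` closure (S \<times> S) \<subseteq> closure S"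
    by (intro image_closure_subset)
      (auto simp: case_prod_unfold intro!: continuous_intros subspace_add[OF S] subsetD[OF closure_subset])
  then show "x + y \<in> closure S" if "x \<in> closure S" "y \<in> closure S" for x y
    using that by (auto simp: closure_Times image_subset_iff)
  have "smul c ` closure S \<subseteq> closure S" for c
    by (intro image_closure_subset)
      (auto intro!: continuous_on_scale continuous_intros subspace_scale[OF S] subsetD[OF closure_subset])
  then show "smul c x \<in> closure S" if "x \<in> closure S" for c x
    using that by blast
qed

end

context ell1_disk
begin

text \<open>Otherwise the kernel would be a closed subspace containing every \<open>y i\<close>,
  hence the whole space.\<close>

lemma functional_nonzero_on_generator:
  assumes dense: "closure (span (range y)) = UNIV"
    and f: "Vector_Spaces.linear smul (*) f" "continuous_on UNIV f" and nz: "f x \<noteq> 0"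
  shows "\<exists>i. f (y i) \<noteq> (0::'k)"
proof (rule ccontr)
  assume "\<not> ?thesis"
  moreover have "subspace {x. f x = 0}"
    using f(1) linear_functional_iff linear_functional_sum[OF f(1), of _ _ "{}"]
    by (intro subspaceI) auto
  ultimately have "span (range y) \<subseteq> {x. f x = 0}" by (intro span_minimal) auto
  moreover have "closed {x. f x = 0}" using f(2) by (intro closed_Collect_eq continuous_intros)
  ultimately have "closure (span (range y)) \<subseteq> {x. f x = 0}" by (rule closure_minimal)
  then show False using dense nz by auto
qed

text \<open>
  The span of the new vector and its predecessors is only required to come \<open>2\<^sup>-\<^sup>k\<close>-close to
  some \<open>y i\<close>: an exact hit is impossible when the remainder of \<open>y i\<close> is in the kernel of \<open>p\<close>.
  Density follows because every \<open>i\<close> is treated infinitely often.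
\<close>

lemma biorthogonal_step:
  fixes g :: "nat \<Rightarrow> 'a \<Rightarrow> 'k"
  assumes p: "seminorm_on smul p" "continuous_on UNIV p"
    and many: "\<forall>E. finite E \<longrightarrow> (\<exists>f M. Vector_Spaces.linear smul (*) f \<and>
      (\<forall>x. norm (f x :: 'k) \<le> M * p x) \<and> (\<forall>e\<in>E. f e = 0) \<and> (\<exists>x. f x \<noteq> 0))"
    and dense: "closure (span (range y)) = UNIV"
    and lin: "\<And>j. j < k \<Longrightarrow> Vector_Spaces.linear smul (*) (g j)"
    and biorth: "\<And>j l. j < k \<Longrightarrow> l < k \<Longrightarrow> g j (e l) = (if j = l then 1 else 0)"
    and disk: "\<And>j. j < k \<Longrightarrow> \<exists>r. in_disk r (e j)"
    and C: "C \<ge> 0"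
  shows "\<exists>e' g' r d. Vector_Spaces.linear smul (*) g' \<and> g' e' = 1 \<and>
    (\<forall>j<k. g' (e j) = 0 \<and> g j e' = 0) \<and> in_disk r e' \<and>
    (\<forall>x. norm (g' x) * C \<le> (1/2)^k * p x) \<and>
    in_disk ((1/2)^k) d \<and> y i + d \<in> span (insert e' (e ` {..<k}))"
proof -
  note vs = vector_space_axioms
  obtain f M where f: "Vector_Spaces.linear smul (*) f" "\<And>x. norm (f x :: 'k) \<le> M * p x"
    "\<And>j. j < k \<Longrightarrow> f (e j) = 0" and "\<exists>x. f x \<noteq> 0"
    using many[rule_format, of "e ` {..<k}"] by auto
  then obtain m where m: "f (y m) \<noteq> 0"
    using functional_nonzero_on_generator[OF dense f(1) continuous_on_linear_functional[OF f(1) p(2,1) f(2)]]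
    by blast
  \<comment> \<open>If \<open>f\<close> vanishes at \<open>y i\<close>, a small multiple of
    \<open>y m\<close> is added so that \<open>f w\<close> is nonzero.\<close>
  define d where "d = (if f (y i) = 0 then smul ((1/2)^k) (y m) else 0)"
  define w where "w = y i + d"
  have d: "in_disk ((1/2)^k) d"
    using in_disk_scale[OF in_disk_member, of "(1/2)^k" m] in_disk_mono[OF in_disk_zero]
    by (auto simp: d_def norm_power norm_divide)
  have "f w \<noteq> 0"
  proof -
    have "f w = f (y i) + f d" "f (smul ((1/2)^k) (y m)) = (1/2)^k * f (y m)"
      using f(1) unfolding linear_functional_iff w_def by blast+
    moreover have "f 0 = 0" using linear_functional_sum[OF f(1), of _ _ "{}"] by simp
    ultimately show ?thesis using m by (auto simp: d_def)
  qed
  \<comment> \<open>Chosen to make \<open>norm c * ((\<bar>M\<bar> + 1) * (C + 1))\<close> equal to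
    \<open>(1/2)^k\<close>; the absolute value and the added ones keep the denominator
    positive.\<close>
  define c :: 'k where "c = of_real ((1/2)^k / ((\<bar>M\<bar> + 1) * (C + 1)))"
  have "(1/2)^k / ((\<bar>M\<bar> + 1) * (C + 1)) > 0" using C by simp
  then have c: "norm c = (1/2)^k / ((\<bar>M\<bar> + 1) * (C + 1))" "c \<noteq> 0"
    unfolding c_def norm_of_real of_real_eq_0_iff by linarith+
  define g' where "g' x = c * f x" for x
  have g': "Vector_Spaces.linear smul (*) g'"
    using f(1) unfolding g'_def linear_functional_iff by (simp add: algebra_simps)
  have g'_bound: "norm (g' x) * C \<le> (1/2)^k * p x" for x
  proof -
    have px: "p x \<ge> 0" by (rule seminorm_on_nonneg[OF vs p(1)])
    have "norm (f x) \<le> (\<bar>M\<bar> + 1) * p x"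
      using f(2)[of x] px by (smt (verit) mult_right_mono)
    then have "norm (f x) * C \<le> ((\<bar>M\<bar> + 1) * p x) * (C + 1)"
      using C px by (intro mult_mono) auto
    then have "norm c * (norm (f x) * C) \<le> norm c * (((\<bar>M\<bar> + 1) * p x) * (C + 1))"
      by (rule mult_left_mono) simp
    also have "\<dots> = norm c * ((\<bar>M\<bar> + 1) * (C + 1)) * p x" by (simp only: mult_ac)
    also have "norm c * ((\<bar>M\<bar> + 1) * (C + 1)) = (1/2)^k" using C unfolding c(1) by simp
    finally show ?thesis by (simp add: g'_def norm_mult mult.assoc)
  qed
  \<comment> \<open>As in Gram-Schmidt, the subtraction annihilates every \<open>g j\<close> with
    \<open>j < k\<close>. It does not change the value of \<open>g'\<close>, because
    \<open>f\<close> vanishes on the earlier vectors; dividing by \<open>g' w\<close> then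
    normalises.\<close>
  define v where "v = w - (\<Sum>j<k. smul (g j w) (e j))"
  define e' where "e' = smul (1 / g' w) v"
  have g'w: "g' w \<noteq> 0" using c \<open>f w \<noteq> 0\<close> by (simp add: g'_def)
  have scaled: "h e' = 1 / g' w * (h w - (\<Sum>j<k. g j w * h (e j)))"
    if h: "Vector_Spaces.linear smul (*) h" for h
  proof -
    have "h e' = 1 / g' w * h v" using h unfolding linear_functional_iff e'_def by blast
    then show ?thesis
      unfolding v_def linear_functional_diff[OF h] linear_functional_sum[OF h] .
  qed
  have "g' e' = 1" using g'w f(3) unfolding scaled[OF g'] by (simp add: g'_def)
  moreover have "g' (e j) = 0" if "j < k" for j using f(3)[OF that] by (simp add: g'_def)
  moreover have "g l e' = 0" if l: "l < k" for l
  proof -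
    have "(\<Sum>j<k. g j w * g l (e j)) = (\<Sum>j<k. if j = l then g l w else 0)"
      using biorth l by (intro sum.cong) auto
    also have "\<dots> = g l w" using l by simp
    finally show ?thesis unfolding scaled[OF lin[OF l]] by simp
  qed
  moreover have "\<exists>r. in_disk r e'"
  proof -
    obtain r where r: "\<And>j. j < k \<Longrightarrow> in_disk (r j) (e j)" using disk by metis
    have "in_disk (\<Sum>j<k. norm (g j w) * r j) (\<Sum>j<k. smul (g j w) (e j))"
      using r by (intro in_disk_sum in_disk_scale) auto
    from in_disk_scale[OF in_disk_add[OF in_disk_add[OF in_disk_member[of i] d] in_disk_minus[OF this]]]
    show ?thesis unfolding e'_def v_def w_def diff_conv_add_uminus by blast
  qed
  moreover have "y i + d \<in> span (insert e' (e ` {..<k}))"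
  proof -
    have "w = smul (g' w) e' + (\<Sum>j<k. smul (g j w) (e j))"
      using g'w by (simp add: e'_def v_def)
    also have "\<dots> \<in> span (insert e' (e ` {..<k}))"
      by (intro span_add span_scale span_sum) (auto intro: span_base)
    finally show ?thesis by (simp add: w_def)
  qed
  ultimately show ?thesis using g' g'_bound d by blast
qed

text \<open>Iterates \<open>biorthogonal_step\<close>. The constant \<open>C\<close> handed to step
  \<open>k\<close> is the binomially weighted sum of the earlier radii, which will bound the disk
  radius of \<open>increment k\<close>.\<close>

lemma biorthogonal_sequence:
  assumes p: "seminorm_on smul p" "continuous_on UNIV p"
    and many: "\<forall>E. finite E \<longrightarrow> (\<exists>f M. Vector_Spaces.linear smul (*) f \<and>
      (\<forall>x. norm (f x :: 'k) \<le> M * p x) \<and> (\<forall>e\<in>E. f e = 0) \<and> (\<exists>x. f x \<noteq> 0))"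
    and dense: "closure (span (range y)) = UNIV"
  obtains e and g :: "nat \<Rightarrow> 'a \<Rightarrow> 'k" and r
  where "\<And>k. Vector_Spaces.linear smul (*) (g k)"
    "\<And>j k. g k (e j) = (if j = k then 1 else 0)"
    "\<And>k. in_disk (r k) (e k)"
    "\<And>k x. norm (g k x) * (\<Sum>j<k. of_nat (k choose j) * r j) \<le> (1/2)^k * p x"
    "closure (span (range e)) = UNIV"
proof -
  let ?e = "\<lambda>s :: 'a \<times> ('a \<Rightarrow> 'k) \<times> real. fst s"
  let ?g = "\<lambda>s :: 'a \<times> ('a \<Rightarrow> 'k) \<times> real. fst (snd s)"
  let ?r = "\<lambda>s :: 'a \<times> ('a \<Rightarrow> 'k) \<times> real. snd (snd s)"
  \<comment> \<open>A state is a triple of vector, functional and radius. The index treated at step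
    \<open>k\<close> is \<open>fst (prod_decode k)\<close>, which takes every value infinitely
    often.\<close>
  define P where "P F k s \<longleftrightarrow> Vector_Spaces.linear smul (*) (?g s) \<and> ?g s (?e s) = 1 \<and>
    (\<forall>j<k. ?g s (?e (F j)) = 0 \<and> ?g (F j) (?e s) = 0) \<and> in_disk (?r s) (?e s) \<and>
    (\<forall>x. norm (?g s x) * (\<Sum>j<k. of_nat (k choose j) * ?r (F j)) \<le> (1/2)^k * p x) \<and>
    (\<exists>d. in_disk ((1/2)^k) d \<and>
       y (fst (prod_decode k)) + d \<in> span (insert (?e s) ((\<lambda>j. ?e (F j)) ` {..<k})))" for F k s
  have "\<exists>F. \<forall>k. P F k (F k)"
  proof (rule dependent_wellorder_choice)
    show "P F k s = P F' k s" if "\<And>j. j < k \<Longrightarrow> F j = F' j" for s F F' k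
    proof -
      have "(\<lambda>j. ?e (F j)) ` {..<k} = (\<lambda>j. ?e (F' j)) ` {..<k}"
        using that by (intro image_cong) auto
      moreover have "(\<Sum>j<k. of_nat (k choose j) * ?r (F j)) = (\<Sum>j<k. of_nat (k choose j) * ?r (F' j))"
        using that by (intro sum.cong) auto
      moreover have "(\<forall>j<k. ?g s (?e (F j)) = 0 \<and> ?g (F j) (?e s) = 0) \<longleftrightarrow>
          (\<forall>j<k. ?g s (?e (F' j)) = 0 \<and> ?g (F' j) (?e s) = 0)"
        using that by auto
      ultimately show ?thesis unfolding P_def by simp
    qed
  next
    fix k F assume IH: "\<And>j. j < k \<Longrightarrow> P F j (F j)"
    have lin: "Vector_Spaces.linear smul (*) (?g (F j))" if "j < k" for j
      using IH[OF that] unfolding P_def by blast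
    have biorth: "?g (F j) (?e (F l)) = (if j = l then 1 else 0)" if "j < k" "l < k" for j l
    proof (cases j l rule: linorder_cases)
      case less
      then show ?thesis using IH[OF that(2)] unfolding P_def by simp
    next
      case equal
      then show ?thesis using IH[OF that(1)] unfolding P_def by simp
    next
      case greater
      then show ?thesis using IH[OF that(1)] unfolding P_def by simp
    qed
    have disk: "in_disk (?r (F j)) (?e (F j))" if "j < k" for j
      using IH[OF that] unfolding P_def by blast
    have "(\<Sum>j<k. of_nat (k choose j) * ?r (F j)) \<ge> 0"
      using in_disk_nonneg[OF disk] by (intro sum_nonneg) auto
    from biorthogonal_step[OF p many dense, where g = "\<lambda>j. ?g (F j)" and e = "\<lambda>j. ?e (F j)" and k = k
        and i = "fst (prod_decode k)", OF lin biorth _ this]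
    obtain e' g' r d where "Vector_Spaces.linear smul (*) g' \<and> g' e' = 1 \<and>
      (\<forall>j<k. g' (?e (F j)) = 0 \<and> ?g (F j) e' = 0) \<and> in_disk r e' \<and>
      (\<forall>x. norm (g' x) * (\<Sum>j<k. of_nat (k choose j) * ?r (F j)) \<le> (1/2)^k * p x) \<and>
      in_disk ((1/2)^k) d \<and>
      y (fst (prod_decode k)) + d \<in> span (insert e' ((\<lambda>j. ?e (F j)) ` {..<k}))"
      using disk by blast
    then show "\<exists>s. P F k s" unfolding P_def by (intro exI[of _ "(e', g', r)"]) auto
  qed
  then obtain F where F: "\<And>k. P F k (F k)" by blast
  define e where "e k = ?e (F k)" for k
  have "?g (F k) (e j) = (if j = k then 1 else 0)" for j k
    using F[of k] F[of j] unfolding P_def e_def by (cases j k rule: linorder_cases) auto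
  moreover have "closure (span (range e)) = UNIV"
  proof -
    have "y i \<in> closure (span (range e))" for i
    proof -
      have "\<exists>d. in_disk ((1/2)^n) d \<and> y i + d \<in> span (range e)" for n
      proof -
        \<comment> \<open>At this step \<open>y i\<close> is treated, and \<open>k \<ge> n\<close>
          makes the error at most \<open>(1/2)^n\<close>.\<close>
        define k where "k = prod_encode (i, n)"
        obtain d where d: "in_disk ((1/2)^k) d"
          "y (fst (prod_decode k)) + d \<in> span (insert (e k) (e ` {..<k}))"
          using F[of k] unfolding P_def e_def by blast
        have "(1/2::real)^k \<le> (1/2)^n"
          unfolding k_def by (intro power_decreasing le_prod_encode_2) auto
        moreover have "span (insert (e k) (e ` {..<k})) \<subseteq> span (range e)" by (intro span_mono) auto
        ultimately have "in_disk ((1/2)^n) d" "y i + d \<in> span (range e)"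
          using d in_disk_mono[OF d(1)] by (auto simp: k_def)
        then show ?thesis by blast
      qed
      then obtain d where d: "\<And>n. in_disk ((1/2)^n) (d n)" "\<And>n. y i + d n \<in> span (range e)"
        by metis
      have "d \<longlonglongrightarrow> 0"
        by (rule in_disk_tendsto[OF d(1)]) (intro LIMSEQ_power_zero, simp)
      then have "(\<lambda>n. y i + d n) \<longlonglongrightarrow> y i + 0" by (intro tendsto_intros)
      then have "y i + 0 \<in> closure (span (range e))"
        using subsetD[OF closure_subset d(2)]
        by (intro Lim_in_closed_set[OF closed_closure, of "\<lambda>n. y i + d n"]) auto
      then show ?thesis by simp
    qed
    then have "span (range y) \<subseteq> closure (span (range e))"
      by (intro span_minimal subspace_closure subspace_span) auto
    then have "closure (span (range y)) \<subseteq> closure (span (range e))"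
      by (rule closure_minimal) simp
    then show ?thesis using dense by auto
  qed
  ultimately show ?thesis
    using F that[of "\<lambda>k. ?g (F k)" e "\<lambda>k. ?r (F k)"] unfolding P_def e_def by blast
qed

end

section \<open>Translations of polynomials\<close>

lemma smult_sum_right: "smult c (\<Sum>i\<in>A. f i) = (\<Sum>i\<in>A. smult c (f i))"
  by (induction A rule: infinite_finite_induct) (simp_all add: smult_add_right)

lemma pcompose_power: "pcompose (p ^ n) q = pcompose p q ^ n"
  by (induction n) (simp_all add: pcompose_1 pcompose_mult)

lemma pcompose_conv_sum:
  assumes "degree p \<le> n"
  shows "pcompose p q = (\<Sum>i\<le>n. smult (coeff p i) (q ^ i))"
proof -
  have "pcompose p q = pcompose (\<Sum>i\<le>n. monom (coeff p i) i) q"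
    using poly_as_sum_of_monoms'[OF assms] by simp
  then show ?thesis
    by (simp add: pcompose_sum monom_altdef pcompose_smult pcompose_power pcompose_pCons)
qed

text \<open>The common degree bound places the sequence in a finite-dimensional space, where
  coefficientwise convergence controls every norm of the coefficients.\<close>

definition poly_tendsto :: "(nat \<Rightarrow> 'k::real_normed_field poly) \<Rightarrow> 'k poly \<Rightarrow> bool" where
  "poly_tendsto P L \<longleftrightarrow>
     (\<exists>D. \<forall>n. degree (P n) \<le> D) \<and> (\<forall>i. (\<lambda>n. coeff (P n) i) \<longlonglongrightarrow> coeff L i)"

lemma poly_tendsto_const: "poly_tendsto (\<lambda>n. P) P"
  unfolding poly_tendsto_def by auto

lemma poly_tendsto_add:
  assumes "poly_tendsto P L" "poly_tendsto Q M"
  shows "poly_tendsto (\<lambda>n. P n + Q n) (L + M)"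
proof -
  obtain D E where "\<And>n. degree (P n) \<le> D" "\<And>n. degree (Q n) \<le> E"
    using assms unfolding poly_tendsto_def by blast
  then have "degree (P n + Q n) \<le> max D E" for n
    by (meson degree_add_le_max max.mono order_trans)
  then show ?thesis using assms unfolding poly_tendsto_def by (auto intro!: tendsto_intros)
qed

lemma poly_tendsto_sum:
  assumes "finite A" "\<And>j. j \<in> A \<Longrightarrow> poly_tendsto (P j) (L j)"
  shows "poly_tendsto (\<lambda>n. \<Sum>j\<in>A. P j n) (\<Sum>j\<in>A. L j)"
  using assms by induction (auto intro: poly_tendsto_add poly_tendsto_const)

lemma poly_tendsto_mult:
  assumes "poly_tendsto P L" "poly_tendsto Q M"
  shows "poly_tendsto (\<lambda>n. P n * Q n) (L * M)"
proof -
  obtain D E where "\<And>n. degree (P n) \<le> D" "\<And>n. degree (Q n) \<le> E"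
    using assms unfolding poly_tendsto_def by blast
  then have "degree (P n * Q n) \<le> D + E" for n
    by (meson degree_mult_le add_mono order_trans)
  then show ?thesis
    using assms unfolding poly_tendsto_def by (auto simp: coeff_mult intro!: tendsto_intros)
qed

lemma poly_tendsto_power:
  "poly_tendsto P L \<Longrightarrow> poly_tendsto (\<lambda>n. P n ^ m) (L ^ m)"
  by (induction m) (auto intro: poly_tendsto_const poly_tendsto_mult)

lemma poly_tendsto_smult:
  assumes "c \<longlonglongrightarrow> l" "poly_tendsto P L"
  shows "poly_tendsto (\<lambda>n. smult (c n) (P n)) (smult l L)"
  using assms unfolding poly_tendsto_def
  by (auto intro!: tendsto_intros intro: order_trans[OF degree_smult_le])

lemma poly_tendsto_pcompose:
  assumes "poly_tendsto P L" "poly_tendsto Q M"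
  shows "poly_tendsto (\<lambda>n. pcompose (P n) (Q n)) (pcompose L M)"
proof -
  obtain D where D: "\<And>n. degree (P n) \<le> D" using assms unfolding poly_tendsto_def by blast
  have L: "degree L \<le> max D (degree L)" and P: "degree (P n) \<le> max D (degree L)" for n
    using D[of n] by auto
  show ?thesis unfolding pcompose_conv_sum[OF P] pcompose_conv_sum[OF L]
    using assms by (intro poly_tendsto_sum poly_tendsto_smult poly_tendsto_power)
      (auto simp: poly_tendsto_def)
qed

lemma poly_tendsto_linear:
  assumes "a \<longlonglongrightarrow> l" "b \<longlonglongrightarrow> m"
  shows "poly_tendsto (\<lambda>n. [:a n, b n:]) [:l, m:]"
  using assms unfolding poly_tendsto_def
  by (auto simp: coeff_pCons split: nat.split intro!: exI[of _ 1])

text \<open>Serves identities involving \<open>1 / of_nat n\<close>, which hold for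
  \<open>n > 0\<close> only; the degree of \<open>Q 0\<close> is absorbed into the bound.\<close>

lemma poly_tendsto_eventually:
  assumes "poly_tendsto P L" "\<And>n. n > 0 \<Longrightarrow> Q n = P n"
  shows "poly_tendsto Q L"
proof -
  obtain D where D: "\<And>n. degree (P n) \<le> D" using assms(1) unfolding poly_tendsto_def by blast
  have "degree (Q n) \<le> max D (degree (Q 0))" for n
    using assms(2)[of n] D[of n] by (cases "n = 0") auto
  moreover have "(\<lambda>n. coeff (Q n) i) \<longlonglongrightarrow> coeff L i" for i
  proof (rule Lim_transform_eventually)
    show "(\<lambda>n. coeff (P n) i) \<longlonglongrightarrow> coeff L i" using assms(1) unfolding poly_tendsto_def by blast
    show "eventually (\<lambda>n. coeff (P n) i = coeff (Q n) i) sequentially"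
      using eventually_gt_at_top[of 0] by eventually_elim (simp add: assms(2))
  qed
  ultimately show ?thesis unfolding poly_tendsto_def by blast
qed

text \<open>The coefficients of w(z + cn) grow at most like n to the power \<open>degree w\<close>,
  while the factor (z/n)^m of E(z/n) contributes n^(-m). In \<open>Q\<close> these powers are
  collected, so that only positive powers of 1/n remain next to a convergent factor.\<close>

lemma poly_tendsto_shifted_scaled:
  fixes w E :: "'k::real_normed_field poly"
  assumes w: "degree w < m" and E: "[:0, 1:] ^ m dvd E"
  shows "poly_tendsto (\<lambda>n. pcompose w [:c * of_nat n, 1:] * pcompose E [:0, 1 / of_nat n:]) 0"
proof -
  obtain E' where E': "E = [:0, 1:] ^ m * E'" using E by blast
  have inv: "(\<lambda>n. 1 / of_nat n :: 'k) \<longlonglongrightarrow> 0"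
    by (rule lim_1_over_n)
  define Q where "Q n = (\<Sum>j\<le>degree w. smult (coeff w j * (1 / of_nat n) ^ (m - j)) ([:c, 1 / of_nat n:] ^ j)) *
    ([:0, 1:] ^ m * pcompose E' [:0, 1 / of_nat n:])" for n
  have "poly_tendsto Q
     ((\<Sum>j\<le>degree w. smult (coeff w j * 0 ^ (m - j)) ([:c, 0:] ^ j)) * ([:0, 1:] ^ m * pcompose E' [:0, 0:]))"
    unfolding Q_def
    by (intro poly_tendsto_mult poly_tendsto_sum poly_tendsto_smult poly_tendsto_power
        poly_tendsto_pcompose poly_tendsto_linear poly_tendsto_const tendsto_intros inv) auto
  moreover have "(\<Sum>j\<le>degree w. smult (coeff w j * 0 ^ (m - j)) ([:c, 0:] ^ j)) = 0"
    using w by (intro sum.neutral) auto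
  ultimately have "poly_tendsto Q 0" by simp
  then show ?thesis
  proof (rule poly_tendsto_eventually)
    fix n :: nat assume "n > 0"
    then have n: "of_nat n \<noteq> (0::'k)" by simp
    have "pcompose w [:c * of_nat n, 1:] * [:0, 1 / of_nat n:] ^ m =
      (\<Sum>j\<le>degree w. smult (coeff w j * (1 / of_nat n) ^ (m - j)) ([:c, 1 / of_nat n:] ^ j)) * [:0, 1:] ^ m"
    proof -
      have "[:c * of_nat n, 1:] = smult (of_nat n) [:c, 1 / of_nat n:]" using n by simp
      then have 1: "pcompose w [:c * of_nat n, 1:] =
        (\<Sum>j\<le>degree w. smult (coeff w j * of_nat n ^ j) ([:c, 1 / of_nat n:] ^ j))"
        by (simp only: pcompose_conv_sum[OF order_refl] smult_power smult_smult)
      have "[:0, 1 / of_nat n:] = smult (1 / of_nat n) [:0, 1 :: 'k:]" by simp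
      then have 2: "[:0, 1 / of_nat n:] ^ m = smult ((1 / of_nat n) ^ m) ([:0, 1 :: 'k:] ^ m)"
        by (simp only: smult_power)
      have "(\<Sum>j\<le>degree w. smult (coeff w j * of_nat n ^ j) ([:c, 1 / of_nat n:] ^ j)) * smult ((1 / of_nat n) ^ m) ([:0, 1:] ^ m)
        = (\<Sum>j\<le>degree w. smult ((1 / of_nat n) ^ m * (coeff w j * of_nat n ^ j)) ([:c, 1 / of_nat n:] ^ j)) * [:0, 1:] ^ m"
        by (simp only: mult_smult_right mult_smult_left[symmetric] smult_sum_right smult_smult)
      also have "(\<Sum>j\<le>degree w. smult ((1 / of_nat n) ^ m * (coeff w j * of_nat n ^ j)) ([:c, 1 / of_nat n:] ^ j)) =
        (\<Sum>j\<le>degree w. smult (coeff w j * (1 / of_nat n) ^ (m - j)) ([:c, 1 / of_nat n:] ^ j))"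
      proof (rule sum.cong[OF refl])
        fix j assume "j \<in> {..degree w}"
        then have "m = (m - j) + j" using w by simp
        then have "(1 / of_nat n :: 'k) ^ m = (1 / of_nat n) ^ (m - j) * (1 / of_nat n) ^ j"
          by (metis power_add)
        then have "(1 / of_nat n) ^ m * (coeff w j * of_nat n ^ j) = coeff w j * (1 / of_nat n) ^ (m - j)"
          using n by (simp add: power_divide)
        then show "smult ((1 / of_nat n) ^ m * (coeff w j * of_nat n ^ j)) ([:c, 1 / of_nat n:] ^ j) =
          smult (coeff w j * (1 / of_nat n) ^ (m - j)) ([:c, 1 / of_nat n:] ^ j)" by (rule arg_cong)
      qed
      finally show ?thesis unfolding 1 2 .
    qed
    then show "pcompose w [:c * of_nat n, 1:] * pcompose E [:0, 1 / of_nat n:] = Q n"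
      unfolding Q_def E' pcompose_mult pcompose_power
      by (simp add: mult.assoc[symmetric] pcompose_pCons)
  qed
qed

text \<open>
  Since \<open>A = 1 - (1 - t^m)^m\<close> vanishes to order \<open>m\<close> at \<open>0\<close> and \<open>1 - A\<close> to order \<open>m\<close> at \<open>1\<close>, the polynomial
  \<open>u(z) (1 - A(z/n)) + v(z - n) A(z/n)\<close> is close to \<open>u\<close> near \<open>0\<close> and to \<open>v(z - n)\<close> near \<open>n\<close>.
\<close>

lemma translation_mixing_polynomials:
  fixes u v :: "'k::real_normed_field poly"
  obtains h where "poly_tendsto h 0"
    "poly_tendsto (\<lambda>n. pcompose (u + h n) [:of_nat n, 1:] - v) 0"
proof -
  define m where "m = Suc (max (degree u) (degree v))"
  have m: "degree u < m" "degree v < m" "m > 0" by (auto simp: m_def)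
  define A :: "'k poly" where "A = 1 - (1 - [:0, 1:] ^ m) ^ m"
  \<comment> \<open>This is 1 - A(t + 1): translating by \<open>n\<close> turns 1 - A(z/n) into
    B(z/n).\<close>
  define B :: "'k poly" where "B = (1 - [:1, 1:] ^ m) ^ m"
  have A: "[:0, 1:] ^ m dvd A"
  proof -
    have "A = (1 - (1 - [:0, 1:] ^ m)) * (\<Sum>i<m. (1 - [:0, 1:] ^ m) ^ i)"
      unfolding A_def by (rule one_diff_power_eq)
    then have "A = [:0, 1:] ^ m * (\<Sum>i<m. (1 - [:0, 1:] ^ m) ^ i)" by simp
    then show ?thesis by (rule dvdI)
  qed
  have B: "[:0, 1:] ^ m dvd B"
  proof -
    have "poly (1 - [:1, 1:] ^ m :: 'k poly) 0 = 0" by (simp add: poly_power)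
    then have "[:- 0, 1:] dvd (1 - [:1, 1:] ^ m :: 'k poly)" by (simp only: poly_eq_0_iff_dvd)
    then show ?thesis unfolding B_def by (intro dvd_power_same) simp
  qed
  define h where "h n = (pcompose v [:- of_nat n, 1:] - u) * pcompose A [:0, 1 / of_nat n:]" for n
  \<comment> \<open>The two summands of \<open>h\<close> are the cases \<open>c = - 1\<close> for
    \<open>v\<close> and \<open>c = 0\<close> for \<open>u\<close>. After the translation the cases
    are \<open>c = 1\<close> for \<open>u\<close> and \<open>c = 0\<close> for
    \<open>v\<close>.\<close>
  have "poly_tendsto (\<lambda>n. pcompose v [:- 1 * of_nat n, 1:] * pcompose A [:0, 1 / of_nat n:] +
      smult (- 1) (pcompose u [:0 * of_nat n, 1:] * pcompose A [:0, 1 / of_nat n:])) (0 + smult (- 1) 0)"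
    by (intro poly_tendsto_add poly_tendsto_smult poly_tendsto_shifted_scaled[where m = m] m A tendsto_const)
  then have 1: "poly_tendsto h 0"
    unfolding h_def by (simp add: left_diff_distrib)
  have "poly_tendsto (\<lambda>n. pcompose u [:1 * of_nat n, 1:] * pcompose B [:0, 1 / of_nat n:] +
      smult (- 1) (pcompose v [:0 * of_nat n, 1:] * pcompose B [:0, 1 / of_nat n:])) (0 + smult (- 1) 0)"
    by (intro poly_tendsto_add poly_tendsto_smult poly_tendsto_shifted_scaled[where m = m] m B tendsto_const)
  then have "poly_tendsto (\<lambda>n. (pcompose u [:of_nat n, 1:] - v) * pcompose B [:0, 1 / of_nat n:]) 0"
    by (simp add: left_diff_distrib)
  then have 2: "poly_tendsto (\<lambda>n. pcompose (u + h n) [:of_nat n, 1:] - v) 0"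
  proof (rule poly_tendsto_eventually)
    fix n :: nat assume "n > 0"
    then have n: "of_nat n \<noteq> (0::'k)" by simp
    have AB: "pcompose (pcompose A [:0, 1 / of_nat n:]) [:of_nat n, 1:] = 1 - pcompose B [:0, 1 / of_nat n:]"
      unfolding A_def B_def pcompose_diff pcompose_1 pcompose_power
      using n by (simp add: pcompose_pCons one_pCons)
    have vn: "pcompose (pcompose v [:- of_nat n, 1:]) [:of_nat n, 1:] = v"
      by (simp add: pcompose_assoc[symmetric] pcompose_pCons)
    show "pcompose (u + h n) [:of_nat n, 1:] - v =
        (pcompose u [:of_nat n, 1:] - v) * pcompose B [:0, 1 / of_nat n:]"
      unfolding h_def pcompose_add pcompose_mult pcompose_diff AB vn by (simp add: algebra_simps)
  qed
  show ?thesis by (rule that[OF 1 2])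
qed

section \<open>The translation operator\<close>

lemma summable_linear_image:
  fixes T :: "'a::{topological_ab_group_add, t2_space} \<Rightarrow> 'a"
  assumes add: "\<And>x y. T (x + y) = T x + T y" and T: "continuous_on UNIV T" and v: "summable v"
  shows "summable (\<lambda>j. T (v j))" "T (suminf v) = (\<Sum>j. T (v j))"
proof -
  have T0: "T 0 = 0" using add[of 0 0] by simp
  have "T (\<Sum>j<n. v j) = (\<Sum>j<n. T (v j))" for n :: nat by (induction n) (simp_all add: add T0)
  moreover have "(\<lambda>n. T (\<Sum>j<n. v j)) \<longlonglongrightarrow> T (suminf v)"
    by (intro continuous_on_tendsto_compose[OF T] summable_LIMSEQ v) auto
  ultimately have "(\<lambda>j. T (v j)) sums T (suminf v)" by (simp add: sums_def)
  then show "summable (\<lambda>j. T (v j))" "T (suminf v) = (\<Sum>j. T (v j))" by (auto simp: sums_iff)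
qed

lemma suminf_split_initial:
  fixes f :: "nat \<Rightarrow> 'a::{topological_ab_group_add, t2_space}"
  assumes f: "summable f"
  shows "suminf f = (\<Sum>n. f (n + k)) + (\<Sum>i<k. f i)"
proof -
  have eq: "(\<Sum>i<n. f (i + k)) = (\<Sum>i<n + k. f i) - (\<Sum>i<k. f i)" for n
    by (induction n) simp_all
  have "(\<lambda>n. (\<Sum>i<n + k. f i) - (\<Sum>i<k. f i)) \<longlonglongrightarrow> suminf f - (\<Sum>i<k. f i)"
    by (intro tendsto_diff tendsto_const LIMSEQ_ignore_initial_segment summable_LIMSEQ f)
  then have "(\<lambda>n. f (n + k)) sums (suminf f - (\<Sum>i<k. f i))"
    unfolding sums_def eq .
  then show ?thesis by (simp add: sums_iff)
qed

locale translation_model = ell1_disk smul y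
  for smul :: "'k::{real_normed_field, euclidean_space} \<Rightarrow> 'a::{topological_ab_group_add, t2_space} \<Rightarrow> 'a"
    and y +
  fixes p :: "'a \<Rightarrow> real" and e :: "nat \<Rightarrow> 'a" and g :: "nat \<Rightarrow> 'a \<Rightarrow> 'k" and r :: "nat \<Rightarrow> real"
  assumes p: "seminorm_on smul p" "continuous_on UNIV p"
    and lin: "\<And>k. Vector_Spaces.linear smul (*) (g k)"
    and biorth: "\<And>j k. g k (e j) = (if j = k then 1 else 0)"
    and disk: "\<And>k. in_disk (r k) (e k)"
    and small: "\<And>k x. norm (g k x) * (\<Sum>j<k. of_nat (k choose j) * r j) \<le> (1/2)^k * p x"
    and dense: "closure (span (range e)) = UNIV"
begin

section \<open>Polynomials as vectors of the space\<close>

definition \<Phi> :: "'k poly \<Rightarrow> 'a" where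
  "\<Phi> P = (\<Sum>i\<le>degree P. smul (coeff P i) (e i))"

text \<open>A disk radius for \<open>\<Phi> P\<close>, given by the triangle inequality. It depends
  on the coefficients alone, so limits of polynomials pass to limits of radii.\<close>

definition \<nu> :: "'k poly \<Rightarrow> real" where
  "\<nu> P = (\<Sum>i\<le>degree P. norm (coeff P i) * r i)"

lemma \<Phi>_eq: "degree P \<le> n \<Longrightarrow> \<Phi> P = (\<Sum>i\<le>n. smul (coeff P i) (e i))"
  unfolding \<Phi>_def by (intro sum.mono_neutral_left) (auto simp: coeff_eq_0)

lemma \<nu>_eq: "degree P \<le> n \<Longrightarrow> \<nu> P = (\<Sum>i\<le>n. norm (coeff P i) * r i)"
  unfolding \<nu>_def by (intro sum.mono_neutral_left) (auto simp: coeff_eq_0)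

lemma in_disk_\<Phi>: "in_disk (\<nu> P) (\<Phi> P)"
  unfolding \<nu>_def \<Phi>_def using disk by (intro in_disk_sum in_disk_scale) auto

lemma \<Phi>_add: "\<Phi> (P + Q) = \<Phi> P + \<Phi> Q"
proof -
  let ?n = "max (degree P) (degree Q)"
  have "degree (P + Q) \<le> ?n" by (rule degree_add_le_max)
  then show ?thesis
    using \<Phi>_eq[of P ?n] \<Phi>_eq[of Q ?n] \<Phi>_eq[of "P + Q" ?n]
    by (simp add: scale_left_distrib sum.distrib)
qed

lemma \<Phi>_smult: "\<Phi> (smult c P) = smul c (\<Phi> P)"
  using \<Phi>_eq[of "smult c P" "degree P"] by (simp add: \<Phi>_def degree_smult_le scale_sum_right)

lemma \<Phi>_zero: "\<Phi> 0 = 0"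
  by (simp add: \<Phi>_def)

lemma \<Phi>_diff: "\<Phi> (P - Q) = \<Phi> P - \<Phi> Q"
  using \<Phi>_add[of "P - Q" Q] by simp

lemma \<Phi>_sum: "\<Phi> (\<Sum>i\<in>A. P i) = (\<Sum>i\<in>A. \<Phi> (P i))"
  by (induction A rule: infinite_finite_induct) (simp_all add: \<Phi>_zero \<Phi>_add)

lemma \<nu>_tendsto:
  assumes "poly_tendsto P 0"
  shows "(\<lambda>n. \<nu> (P n)) \<longlonglongrightarrow> 0"
proof -
  obtain D where D: "\<And>n. degree (P n) \<le> D" using assms unfolding poly_tendsto_def by blast
  have "(\<lambda>n. coeff (P n) i) \<longlonglongrightarrow> 0" for i
    using assms unfolding poly_tendsto_def by simp
  then have "(\<lambda>n. \<Sum>i\<le>D. norm (coeff (P n) i) * r i) \<longlonglongrightarrow> (\<Sum>i\<le>D. norm (0::'k) * r i)"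
    by (intro tendsto_intros)
  then show ?thesis by (simp add: \<nu>_eq[OF D])
qed

lemma \<Phi>_tendsto:
  assumes "poly_tendsto (\<lambda>n. P n - L) 0"
  shows "(\<lambda>n. \<Phi> (P n)) \<longlonglongrightarrow> \<Phi> L"
proof -
  have "(\<lambda>n. \<Phi> (P n - L)) \<longlonglongrightarrow> 0" by (rule in_disk_tendsto[OF in_disk_\<Phi> \<nu>_tendsto[OF assms]])
  then have "(\<lambda>n. \<Phi> (P n - L) + \<Phi> L) \<longlonglongrightarrow> 0 + \<Phi> L" by (intro tendsto_intros)
  then show ?thesis by (simp add: \<Phi>_diff)
qed

lemma \<Phi>_dense:
  assumes "open W" "W \<noteq> {}"
  shows "\<exists>P. \<Phi> P \<in> W"
proof -
  have "\<Phi> (monom 1 k) = e k" for k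
    by (simp add: \<Phi>_def degree_monom_eq if_distrib[of "\<lambda>c. smul c _"] cong: if_cong)
  then have "range e \<subseteq> range \<Phi>" by (metis image_subsetI rangeI)
  moreover have "subspace (range \<Phi>)"
  proof (rule subspaceI)
    show "0 \<in> range \<Phi>" using rangeI[of \<Phi> 0] by (simp add: \<Phi>_zero)
  qed (auto simp flip: \<Phi>_add \<Phi>_smult)
  ultimately have "span (range e) \<subseteq> range \<Phi>" by (rule span_minimal)
  moreover have "W \<inter> span (range e) \<noteq> {}"
    using assms dense by (metis Int_UNIV_right open_Int_closure_eq_empty)
  ultimately show ?thesis by blast
qed

text \<open>
  Under \<open>\<Phi>\<close>, the vector \<open>e k\<close> stands for \<open>z^k\<close> and \<open>increment k\<close> for
  \<open>(z + 1)^k - z^k\<close>, so \<open>T\<close> extends the translation \<open>P(z) \<mapsto> P(z + 1)\<close>.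
\<close>

definition increment :: "nat \<Rightarrow> 'a" where
  "increment k = (\<Sum>j<k. smul (of_nat (k choose j)) (e j))"

definition T :: "'a \<Rightarrow> 'a" where
  "T x = x + (\<Sum>k. smul (g k x) (increment k))"

text \<open>The sum in \<open>small\<close> is a disk radius of \<open>increment k\<close>, so
  multiplying by \<open>norm (g k x)\<close> leaves the geometric bound.\<close>

lemma in_disk_T_term: "in_disk ((1/2)^k * p x) (smul (g k x) (increment k))"
proof -
  have "in_disk (\<Sum>j<k. norm (of_nat (k choose j) :: 'k) * r j) (increment k)"
    unfolding increment_def using disk by (intro in_disk_sum in_disk_scale) auto
  from in_disk_scale[OF this, of "g k x"] small[of k x] show ?thesis
    by (auto intro: in_disk_mono)
qed

lemma summable_T: "summable (\<lambda>k. smul (g k x) (increment k))"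
  and in_disk_T: "in_disk (2 * p x) (T x - x)"
proof -
  have "(\<lambda>k. (1/2)^k * p x) sums (1 / (1 - 1/2) * p x)"
    by (intro sums_mult2 geometric_sums) simp
  then have "summable (\<lambda>k. (1/2)^k * p x)" "(\<Sum>k. (1/2)^k * p x) = 2 * p x"
    by (auto simp: sums_iff)
  with in_disk_suminf[of "\<lambda>k. (1/2)^k * p x" "\<lambda>k. smul (g k x) (increment k)", OF in_disk_T_term]
  show "summable (\<lambda>k. smul (g k x) (increment k))" "in_disk (2 * p x) (T x - x)"
    by (auto simp: T_def)
qed

lemma T_add: "T (x + x') = T x + T x'"
proof -
  have "smul (g k (x + x')) (increment k) = smul (g k x) (increment k) + smul (g k x') (increment k)" for k
    using lin[of k] unfolding linear_functional_iff by (simp add: scale_left_distrib)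
  then show ?thesis
    using suminf_add[OF summable_T[of x] summable_T[of x']] by (simp add: T_def)
qed

lemma T_scale: "T (smul c x) = smul c (T x)"
proof -
  have "g k (smul c x) = c * g k x" for k using lin[of k] unfolding linear_functional_iff by blast
  then have eq: "smul (g k (smul c x)) (increment k) = smul c (smul (g k x) (increment k))" for k by simp
  have "continuous_on UNIV (smul c)" by (intro continuous_on_scale continuous_intros)
  from summable_linear_image(2)[OF _ this summable_T[of x]] show ?thesis
    unfolding T_def eq by (simp add: scale_right_distrib)
qed

text \<open>By additivity and \<open>in_disk_T\<close>, the vector
  \<open>T z - T x - (z - x)\<close> has disk radius \<open>2 * p (z - x)\<close>, which tends to 0
  as \<open>z\<close> tends to \<open>x\<close>.\<close>

lemma continuous_T: "continuous_on UNIV T"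
  unfolding continuous_on_def
proof
  fix x
  have diff: "T (z - x) = T z - T x" for z using T_add[of "z - x" x] by simp
  have "continuous_on UNIV (\<lambda>z. 2 * p (z - x))"
    by (intro continuous_intros continuous_on_compose2[OF p(2)]) auto
  then have "((\<lambda>z. 2 * p (z - x)) \<longlongrightarrow> 2 * p (x - x)) (at x)"
    unfolding continuous_on_def by blast
  then have "((\<lambda>z. 2 * p (z - x)) \<longlongrightarrow> 0) (at x)"
    using seminorm_on_zero[OF vector_space_axioms p(1)] by simp
  then have "((\<lambda>z. T (z - x) - (z - x)) \<longlongrightarrow> 0) (at x)"
    by (rule in_disk_tendsto[OF in_disk_T])
  then have "((\<lambda>z. T (z - x) - (z - x) + (z - x) + T x) \<longlongrightarrow> 0 + (x - x) + T x) (at x)"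
    by (intro tendsto_intros)
  then show "(T \<longlongrightarrow> T x) (at x)" by (simp add: diff)
qed

lemma T_operator: "T \<in> continuous_linear_operators smul"
  unfolding continuous_linear_operators_def
  using T_add T_scale continuous_T vector_space_axioms by (auto simp: Vector_Spaces.linear_iff)

text \<open>By biorthogonality \<open>g k\<close> reads off the k-th coefficient, so the series is
  finite; the binomial theorem identifies \<open>e k + increment k\<close> with (z + 1)^k.\<close>

lemma T_\<Phi>: "T (\<Phi> P) = \<Phi> (pcompose P [:1, 1:])"
proof -
  let ?n = "degree P"
  have g\<Phi>: "g k (\<Phi> P) = coeff P k" for k
  proof -
    have "g k (\<Phi> P) = (\<Sum>i\<le>?n. coeff P i * g k (e i))"
      unfolding \<Phi>_def by (rule linear_functional_sum[OF lin])
    also have "\<dots> = (\<Sum>i\<le>?n. if i = k then coeff P k else 0)"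
      using biorth by (intro sum.cong) auto
    finally show ?thesis by (simp add: coeff_eq_0)
  qed
  have "(\<Sum>k. smul (g k (\<Phi> P)) (increment k)) = (\<Sum>k\<le>?n. smul (coeff P k) (increment k))"
    unfolding g\<Phi> by (intro suminf_finite) (auto simp: coeff_eq_0)
  then have "T (\<Phi> P) = (\<Sum>k\<le>?n. smul (coeff P k) (e k + increment k))"
    by (simp add: T_def \<Phi>_def scale_right_distrib sum.distrib)
  also have "e k + increment k = \<Phi> ([:1, 1:] ^ k)" for k
  proof -
    have "degree ([:1, 1 :: 'k:] ^ k) \<le> k" using degree_power_le[of "[:1, 1 :: 'k:]" k] by simp
    then have "\<Phi> ([:1, 1:] ^ k) = (\<Sum>j\<le>k. smul (of_nat (k choose j)) (e j))"
      by (subst \<Phi>_eq) (auto simp: coeff_linear_poly_power)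
    then show ?thesis by (simp add: increment_def lessThan_Suc_atMost[symmetric] add.commute)
  qed
  then have "(\<Sum>k\<le>?n. smul (coeff P k) (e k + increment k)) = \<Phi> (pcompose P [:1, 1:])"
    by (simp add: pcompose_conv_sum[OF order_refl] \<Phi>_sum \<Phi>_smult)
  finally show ?thesis .
qed

lemma T_power_\<Phi>: "(T ^^ n) (\<Phi> P) = \<Phi> (pcompose P [:of_nat n, 1:])"
proof (induction n)
  case (Suc n)
  have "pcompose (pcompose P [:of_nat n, 1:]) [:1, 1:] = pcompose P [:of_nat (Suc n), 1:]"
    by (simp add: pcompose_assoc[symmetric] pcompose_pCons add.commute)
  then show ?case using Suc by (simp add: T_\<Phi>)
qed simp

lemma T_power_add: "(T ^^ n) (x + x') = (T ^^ n) x + (T ^^ n) x'"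
  by (induction n) (simp_all add: T_add)

lemma continuous_T_power: "continuous_on UNIV (T ^^ n)"
proof (induction n)
  case (Suc n)
  have "continuous_on UNIV (\<lambda>x. T ((T ^^ n) x))"
    by (rule continuous_on_compose2[OF continuous_T Suc]) simp
  then show ?case by (simp add: o_def)
qed (simp add: continuous_on_id)

section \<open>Dynamics of the operator\<close>

lemma mixing_T: "mixing T"
  unfolding mixing_def
proof (intro allI impI, elim conjE)
  fix U V :: "'a set" assume UV: "open U" "U \<noteq> {}" "open V" "V \<noteq> {}"
  obtain P Q where PQ: "\<Phi> P \<in> U" "\<Phi> Q \<in> V" using \<Phi>_dense UV by blast
  \<comment> \<open>The vectors \<open>\<Phi> (P + h n)\<close> tend to \<open>\<Phi> P\<close>,
    while their n-th iterates tend to \<open>\<Phi> Q\<close>.\<close>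
  obtain h where h: "poly_tendsto h 0" "poly_tendsto (\<lambda>n. pcompose (P + h n) [:of_nat n, 1:] - Q) 0"
    by (rule translation_mixing_polynomials)
  have "(\<lambda>n. \<Phi> (P + h n)) \<longlonglongrightarrow> \<Phi> P" using h(1) by (intro \<Phi>_tendsto) simp
  then have "eventually (\<lambda>n. \<Phi> (P + h n) \<in> U) sequentially" using UV PQ by (intro topological_tendstoD)
  moreover have "eventually (\<lambda>n. (T ^^ n) (\<Phi> (P + h n)) \<in> V) sequentially"
    unfolding T_power_\<Phi> using UV PQ \<Phi>_tendsto[OF h(2)] by (intro topological_tendstoD)
  ultimately have "eventually (\<lambda>n. (T ^^ n) ` U \<inter> V \<noteq> {}) sequentially"
    by eventually_elim blast
  then obtain N where "\<And>n. n \<ge> N \<Longrightarrow> (T ^^ n) ` U \<inter> V \<noteq> {}"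
    unfolding eventually_sequentially by blast
  then show "\<exists>r>0. \<forall>n>r. (T ^^ n) ` U \<inter> V \<noteq> {}" by (intro exI[of _ "Suc N"]) simp
qed

text \<open>Polynomials with coefficients in a countable dense set of scalars suffice. The clause
  \<open>j \<ge> N\<close> allows an error at index \<open>j\<close> that shrinks with
  \<open>j\<close>.\<close>

lemma target_sequence:
  "\<exists>v :: nat \<Rightarrow> 'k poly. \<forall>W N. open W \<longrightarrow> W \<noteq> {} \<longrightarrow> (\<exists>j\<ge>N::nat. \<Phi> (v j) \<in> W)"
proof -
  obtain D :: "'k set" where D: "countable D" "\<And>X. open X \<Longrightarrow> X \<noteq> {} \<Longrightarrow> \<exists>d\<in>D. d \<in> X"
    using countable_dense_setE by blast
  define S where "S = Poly ` lists D"
  have S: "countable S" "S \<noteq> {}" using D(1) by (auto simp: S_def)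
  have S_dense: "\<exists>Q\<in>S. \<Phi> Q \<in> W" if W: "open W" "W \<noteq> {}" for W
  proof -
    obtain P where P: "\<Phi> P \<in> W" using \<Phi>_dense[OF W] by blast
    have "\<exists>d\<in>D. dist d (coeff P i) < 1 / Suc n" for i n
      using D(2)[of "ball (coeff P i) (1 / Suc n)"] by (auto simp: dist_commute)
    then obtain q where q: "\<And>i n. q i n \<in> D" "\<And>i n. dist (q i n) (coeff P i) < 1 / Suc n" by metis
    define R where "R n = Poly (map (\<lambda>i. q i n) [0..<Suc (degree P)])" for n
    have "q i \<longlonglongrightarrow> coeff P i" for i
    proof (rule metric_tendsto_imp_tendsto)
      show "(\<lambda>n. 1 / real (Suc n)) \<longlonglongrightarrow> 0" by (rule LIMSEQ_Suc[OF lim_1_over_n])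
      show "eventually (\<lambda>n. dist (q i n) (coeff P i) \<le> dist (1 / real (Suc n)) 0) sequentially"
        using q(2) by (simp add: less_imp_le)
    qed
    then have lim: "(\<lambda>n. q i n - coeff P i) \<longlonglongrightarrow> 0" for i by (simp add: LIM_zero)
    have coeff: "coeff (R n - P) i = (if i \<le> degree P then q i n - coeff P i else 0)" for n i
      by (auto simp: R_def nth_default_def coeff_eq_0 simp del: upt_Suc)
    have "degree (R n - P) \<le> degree P" for n
      by (rule degree_le) (auto simp: coeff simp del: coeff_diff)
    moreover have "(\<lambda>n. coeff (R n - P) i) \<longlonglongrightarrow> 0" for i
      unfolding coeff using lim[of i] by (cases "i \<le> degree P") auto
    ultimately have "poly_tendsto (\<lambda>n. R n - P) 0" unfolding poly_tendsto_def coeff_0 by blast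
    from topological_tendstoD[OF \<Phi>_tendsto[OF this] W(1) P]
    obtain n where "\<Phi> (R n) \<in> W" using eventually_happens'[OF sequentially_bot] by blast
    moreover have "R n \<in> S" unfolding R_def S_def using q(1) by (intro imageI) auto
    ultimately show ?thesis by blast
  qed
  \<comment> \<open>The first component of \<open>prod_decode\<close> makes every element of
    \<open>S\<close> recur at arbitrarily large indices.\<close>
  define v where "v j = from_nat_into S (fst (prod_decode j))" for j
  have "\<exists>j\<ge>N. \<Phi> (v j) \<in> W" if W: "open W" "W \<noteq> {}" for W N
  proof -
    obtain Q where Q: "Q \<in> S" "\<Phi> Q \<in> W" using S_dense[OF W] by blast
    then obtain m where "from_nat_into S m = Q" using from_nat_into_surj[OF S(1)] by blast
    then have "\<Phi> (v (prod_encode (m, N))) \<in> W" using Q by (simp add: v_def)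
    then show ?thesis using le_prod_encode_2 by blast
  qed
  then show ?thesis by blast
qed

text \<open>The space need not be metrizable or complete, so the vector is built explicitly as a sum
  of corrections \<open>\<Phi> (h j)\<close>. Correction \<open>j\<close> brings the iterate at time
  \<open>m j\<close> close to \<open>\<Phi> (v j)\<close>, and later corrections are small enough
  not to spoil this.\<close>

lemma hereditarily_hypercyclic_T: "hereditarily_hypercyclic T"
  unfolding hereditarily_hypercyclic_def
proof (intro allI impI)
  fix n :: "nat \<Rightarrow> nat" assume n: "filterlim n at_top sequentially"
  obtain v :: "nat \<Rightarrow> 'k poly" where v: "\<And>W N. open W \<Longrightarrow> W \<noteq> {} \<Longrightarrow> \<exists>j\<ge>N. \<Phi> (v j) \<in> W"
    using target_sequence by blast
  let ?\<tau> = "\<lambda>m P. pcompose P [:of_nat m, 1 :: 'k:]"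
  \<comment> \<open>A stage is a pair of a correction and an index into \<open>n\<close>. The
    clauses make the series converge, protect the earlier approximations, and reach the target
    \<open>v j\<close>.\<close>
  define A where "A F j s \<longleftrightarrow> \<nu> (fst s) \<le> (1/2)^j \<and>
    (\<forall>i<j. \<nu> (?\<tau> (n (snd (F i))) (fst s)) \<le> (1/2)^j) \<and>
    \<nu> (?\<tau> (n (snd s)) ((\<Sum>i<j. fst (F i)) + fst s) - v j) \<le> (1/2)^j"
    for F :: "nat \<Rightarrow> 'k poly \<times> nat" and j and s
  have "\<exists>F. \<forall>j. A F j (F j)"
  proof (rule dependent_wellorder_choice)
    show "A F j s = A F' j s" if "\<And>i. i < j \<Longrightarrow> F i = F' i" for s F F' j
    proof -
      have "(\<Sum>i<j. fst (F i)) = (\<Sum>i<j. fst (F' i))" using that by (intro sum.cong) auto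
      then show ?thesis using that unfolding A_def by simp
    qed
    show "\<exists>s. A F j s" for F j
    proof -
      \<comment> \<open>The starting polynomial is the sum of the earlier corrections, and the
        target is \<open>v j\<close>.\<close>
      obtain h where h: "poly_tendsto h 0"
        "poly_tendsto (\<lambda>m. ?\<tau> m ((\<Sum>i<j. fst (F i)) + h m) - v j) 0"
        by (rule translation_mixing_polynomials)
      have ev: "eventually (\<lambda>m. \<nu> (P m) < (1/2)^j) sequentially" if "poly_tendsto P 0" for P
        using \<nu>_tendsto[OF that] by (rule order_tendstoD) simp
      have "poly_tendsto (\<lambda>m. ?\<tau> k (h m)) 0" for k
        using poly_tendsto_pcompose[OF h(1) poly_tendsto_const] by simp
      then have "eventually (\<lambda>m. \<forall>i\<in>{..<j}. \<nu> (?\<tau> (n (snd (F i))) (h m)) < (1/2)^j) sequentially"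
        by (intro eventually_ball_finite ballI ev) auto
      with ev[OF h(1)] ev[OF h(2)] have "eventually (\<lambda>m. \<nu> (h m) < (1/2)^j \<and> \<nu> (?\<tau> m ((\<Sum>i<j. fst (F i)) + h m) - v j) < (1/2)^j \<and>
        (\<forall>i\<in>{..<j}. \<nu> (?\<tau> (n (snd (F i))) (h m)) < (1/2)^j)) sequentially"
        by (intro eventually_conj)
      \<comment> \<open>All sufficiently large times are suitable, so one can be taken from the
        given sequence because it tends to infinity.\<close>
      then have "eventually (\<lambda>k. \<nu> (h (n k)) < (1/2)^j \<and>
        \<nu> (?\<tau> (n k) ((\<Sum>i<j. fst (F i)) + h (n k)) - v j) < (1/2)^j \<and>
        (\<forall>i\<in>{..<j}. \<nu> (?\<tau> (n (snd (F i))) (h (n k))) < (1/2)^j)) sequentially"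
        by (rule eventually_compose_filterlim[OF _ n])
      then obtain k where "\<nu> (h (n k)) < (1/2)^j \<and>
        \<nu> (?\<tau> (n k) ((\<Sum>i<j. fst (F i)) + h (n k)) - v j) < (1/2)^j \<and>
        (\<forall>i\<in>{..<j}. \<nu> (?\<tau> (n (snd (F i))) (h (n k))) < (1/2)^j)"
        using eventually_happens'[OF sequentially_bot] by blast
      then show ?thesis unfolding A_def by (intro exI[of _ "(h (n k), k)"]) (auto intro: less_imp_le)
    qed
  qed
  then obtain F where F: "\<And>j. A F j (F j)" by blast
  define h where "h j = fst (F j)" for j
  define m where "m j = n (snd (F j))" for j
  have h: "\<nu> (h j) \<le> (1/2)^j" "i < j \<Longrightarrow> \<nu> (?\<tau> (m i) (h j)) \<le> (1/2)^j"
    "\<nu> (?\<tau> (m j) ((\<Sum>i<j. h i) + h j) - v j) \<le> (1/2)^j" for i j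
    using F[of j] unfolding A_def h_def m_def by auto
  have sum_h: "summable (\<lambda>j. \<Phi> (h j))"
    by (rule in_disk_suminf(1)[OF in_disk_mono[OF in_disk_\<Phi> h(1)]]) (simp add: summable_geometric)
  define x where "x = (\<Sum>j. \<Phi> (h j))"
  \<comment> \<open>One \<open>(1/2)^i\<close> is the approximation error of stage \<open>i\<close>;
    the other is the sum over \<open>j > i\<close> of the disturbances by later corrections.\<close>
  have approx: "in_disk (2 * (1/2)^i) ((T ^^ m i) x - \<Phi> (v i))" for i
  proof -
    note image = summable_linear_image[OF T_power_add continuous_T_power sum_h, of "m i"]
    have "(T ^^ m i) x = (\<Sum>j. (T ^^ m i) (\<Phi> (h j)))" unfolding x_def by (rule image(2))
    also have "\<dots> = (\<Sum>j. \<Phi> (?\<tau> (m i) (h (j + Suc i)))) + (\<Sum>j<Suc i. (T ^^ m i) (\<Phi> (h j)))"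
      unfolding T_power_\<Phi>[symmetric] by (rule suminf_split_initial[OF image(1)])
    also have "(\<Sum>j<Suc i. (T ^^ m i) (\<Phi> (h j))) = \<Phi> (?\<tau> (m i) ((\<Sum>j<i. h j) + h i))"
      by (simp add: T_power_\<Phi> \<Phi>_sum \<Phi>_add pcompose_add pcompose_sum)
    finally have eq: "(T ^^ m i) x - \<Phi> (v i) = (\<Sum>j. \<Phi> (?\<tau> (m i) (h (j + Suc i)))) +
        \<Phi> (?\<tau> (m i) ((\<Sum>j<i. h j) + h i) - v i)"
      by (simp add: \<Phi>_diff)
    have "(\<lambda>j. (1/2)^j * (1/2)^Suc i :: real) sums (1 / (1 - 1/2) * (1/2)^Suc i)"
      by (intro sums_mult2 geometric_sums) simp
    then have geo: "summable (\<lambda>j. (1/2::real)^(j + Suc i))" "(\<Sum>j. (1/2::real)^(j + Suc i)) = (1/2)^i"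
      by (simp_all add: sums_iff power_add)
    have "in_disk ((1/2)^(j + Suc i)) (\<Phi> (?\<tau> (m i) (h (j + Suc i))))" for j
      by (rule in_disk_mono[OF in_disk_\<Phi> h(2)]) simp
    from in_disk_suminf(2)[OF this geo(1)]
    have "in_disk ((1/2)^i) (\<Sum>j. \<Phi> (?\<tau> (m i) (h (j + Suc i))))" unfolding geo(2) .
    from in_disk_add[OF this in_disk_mono[OF in_disk_\<Phi> h(3)[of i]]] show ?thesis
      unfolding eq by simp
  qed
  have "range (\<lambda>k. (T ^^ n k) x) \<inter> W \<noteq> {}" if W: "open W" "W \<noteq> {}" for W
  proof -
    obtain w where w: "w \<in> W" using W by blast
    have "open ((\<lambda>(a, b). a + b) -` W)"
      by (intro open_vimage W) (auto simp: case_prod_unfold intro!: continuous_intros)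
    moreover have "(0, w) \<in> (\<lambda>(a, b). a + b) -` W" using w by simp
    ultimately obtain U V where UV: "open U" "open V" "0 \<in> U" "w \<in> V"
      "U \<times> V \<subseteq> (\<lambda>(a, b). a + b) -` W"
      by (auto elim!: open_prod_elim)
    obtain d where d: "d > 0" "\<And>z. in_disk d z \<Longrightarrow> z \<in> U" using in_disk_nbhd[OF UV(1,3)] by blast
    have "(\<lambda>i. 2 * (1/2::real)^i) \<longlonglongrightarrow> 2 * 0" by (intro tendsto_intros LIMSEQ_power_zero) simp
    then have "eventually (\<lambda>i. 2 * (1/2::real)^i < d) sequentially" using d(1) by (intro order_tendstoD) auto
    then obtain N where N: "\<And>i. i \<ge> N \<Longrightarrow> 2 * (1/2::real)^i < d" unfolding eventually_sequentially by blast
    obtain i where i: "i \<ge> N" "\<Phi> (v i) \<in> V" using v[OF UV(2)] UV(4) by blast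
    have "(T ^^ m i) x - \<Phi> (v i) \<in> U" using N[OF i(1)] by (intro d(2) in_disk_mono[OF approx]) simp
    then have "(T ^^ m i) x \<in> W" using UV(5) i(2) by force
    then show ?thesis unfolding m_def by blast
  qed
  \<comment> \<open>If the closure were proper, its complement would be a nonempty open set missing
    the orbit.\<close>
  from this[of "- closure (range (\<lambda>k. (T ^^ n k) x))"]
  have "closure (range (\<lambda>k. (T ^^ n k) x)) = UNIV"
    using closure_subset[of "range (\<lambda>k. (T ^^ n k) x)"] by blast
  then show "\<exists>x. closure (range (\<lambda>k. (T ^^ n k) x)) = UNIV" by blast
qed

end

lemma vector_space_if_class_M: "class_M smul \<Longrightarrow> vector_space smul"
  unfolding class_M_def locally_convex_space_def by blast

theorem class_M_operator:
  fixes smul :: "'k::{real_normed_field, euclidean_space} \<Rightarrow> 'a::{topological_ab_group_add, t2_space} \<Rightarrow> 'a"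
  assumes M: "class_M smul" and nf: "norming_functionals_exist smul"
  shows "\<exists>T\<in>continuous_linear_operators smul. hereditarily_hypercyclic T \<and> mixing T"
proof -
  obtain y where y: "ell1_sequence smul y" "closure (module.span smul (range y)) = UNIV"
    using M unfolding class_M_def by blast
  interpret locally_convex_space smul using M unfolding class_M_def by blast
  interpret ell1_disk smul y by unfold_locales (rule y)
  obtain p where p: "seminorm_on smul p" "continuous_on UNIV p"
    and many: "\<forall>E. finite E \<longrightarrow> (\<exists>f M. Vector_Spaces.linear smul (*) f \<and>
      (\<forall>x. norm (f x :: 'k) \<le> M * p x) \<and> (\<forall>e\<in>E. f e = 0) \<and> (\<exists>x. f x \<noteq> 0))"
    using seminorm_with_many_functionals[OF nf] M unfolding class_M_def by blast
  obtain e and g :: "nat \<Rightarrow> 'a \<Rightarrow> 'k" and r where "\<And>k. Vector_Spaces.linear smul (*) (g k)"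
    "\<And>j k. g k (e j) = (if j = k then 1 else 0)" "\<And>k. in_disk (r k) (e k)"
    "\<And>k x. norm (g k x) * (\<Sum>j<k. of_nat (k choose j) * r j) \<le> (1/2)^k * p x"
    "closure (span (range e)) = UNIV"
    by (rule biorthogonal_sequence[OF p many y(2)]) (rule that)
  then interpret translation_model smul y p e g r
    using p by (intro translation_model.intro translation_model_axioms.intro ell1_disk_axioms)
  show ?thesis using T_operator hereditarily_hypercyclic_T mixing_T by blast
qed

theorem corollary1p4:
  fixes smul\<^sub>R :: "real \<Rightarrow> 'a::{topological_ab_group_add, t2_space} \<Rightarrow> 'a"
    and smul\<^sub>C :: "complex \<Rightarrow> 'b::{topological_ab_group_add, t2_space} \<Rightarrow> 'b"
  shows "(class_M smul\<^sub>R \<longrightarrow>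
            (\<exists>T \<in> continuous_linear_operators smul\<^sub>R. hereditarily_hypercyclic T \<and> mixing T)) \<and>
         (class_M smul\<^sub>C \<longrightarrow>
            (\<exists>T \<in> continuous_linear_operators smul\<^sub>C. hereditarily_hypercyclic T \<and> mixing T))"
  by (intro conjI impI class_M_operator norming_functionals_exist_real
      norming_functionals_exist_complex vector_space_if_class_M)

end
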